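(* Let $d \geq 4$ and let $E \subset \mathbb{R}^d$ be a compact set. If $\dim_H(E) > \frac{2}{3}d+1$, then the set of angles $$\mathcal{A}(E) = \left\{ \alpha(x,z,y) : x,y,z \in E \text{ distinct} \right\} \subset \mathbb{R}$$ has nonempty interior (in $\mathbb{R}$).
   Context: $\dim_H$ denotes Hausdorff dimension. For distinct points $x,y,z\in\mathbb{R}^d$, $\alpha(x,z,y)\in[0,\pi]$ denotes the angle formed by $x,y,z$ centered at $z$, i.e. the angle between the vectors $x-z$ and $y-z$. *)

theory Defs
  imports "HOL-Analysis.Analysis"
begin

text \<open>The term \<open>(diam U)\<^sup>s\<close>, with the usual conventions that the empty set contributes \<open>0\<close> and
  that \<open>0\<^sup>0 = 1\<close> for nonempty sets (whereas \<open>0 powr 0 = 0\<close> in HOL).\<close>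

definition hausdorff_weight :: "real \<Rightarrow> 'a::metric_space set \<Rightarrow> ennreal" where
  "hausdorff_weight s U =
     (if U = {} then 0 else if s = 0 then 1 else ennreal (diameter U powr s))"

text \<open>Boundedness is required explicitly because \<^const>\<open>diameter\<close> is unspecified on unbounded sets.
  Since empty sets are allowed, covers by sequences include finite covers.\<close>

definition hausdorff_premeasure :: "real \<Rightarrow> real \<Rightarrow> 'a::metric_space set \<Rightarrow> ennreal" where
  "hausdorff_premeasure s \<delta> E =
     (INF U \<in> {U :: nat \<Rightarrow> 'a set. (\<forall>i. bounded (U i) \<and> diameter (U i) \<le> \<delta>) \<and> E \<subseteq> (\<Union>i. U i)}.
        \<Sum>i. hausdorff_weight s (U i))"

definition hausdorff_measure :: "real \<Rightarrow> 'a::metric_space set \<Rightarrow> ennreal" where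
  "hausdorff_measure s E = (SUP \<delta> \<in> {0<..}. hausdorff_premeasure s \<delta> E)"

text \<open>The value is \<open>\<infinity>\<close> if no \<open>s\<close> gives measure zero.\<close>

definition hausdorff_dim :: "'a::metric_space set \<Rightarrow> ereal" where
  "hausdorff_dim E = (INF s \<in> {s. 0 \<le> s \<and> hausdorff_measure s E = 0}. ereal s)"

text \<open>The middle argument is the vertex: \<open>angle x z y\<close> is the angle between \<open>x - z\<close> and \<open>y - z\<close>.
  It is only meaningful for \<open>x \<noteq> z\<close> and \<open>y \<noteq> z\<close>.\<close>

definition angle :: "'a::real_inner \<Rightarrow> 'a \<Rightarrow> 'a \<Rightarrow> real" where
  "angle x z y = arccos (((x - z) \<bullet> (y - z)) / (norm (x - z) * norm (y - z)))"

definition angle_set :: "'a::real_inner set \<Rightarrow> real set" where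
  "angle_set E =
     {angle x z y | x y z. x \<in> E \<and> y \<in> E \<and> z \<in> E \<and> x \<noteq> y \<and> y \<noteq> z \<and> x \<noteq> z}"

end

theory Submission
  imports Defs "HOL-Probability.Probability" "HOL-Real_Asymp.Real_Asymp"
begin

text \<open>Look at \<open>E\<close> from one of its points \<open>z\<close>. The angle at \<open>z\<close> depends only on the directions of
  \<open>x - z\<close> and \<open>y - z\<close>, which are points of a sphere of dimension \<open>n = d - 1\<close>. Stereographic
  projection \<open>u\<close> from that sphere to \<open>n\<close>-dimensional space distorts chords by a product of two
  functions of one point each: \<open>2 (1 - cos \<theta>) = |u - u'|\<^sup>2 A A'\<close> (\<open>stereo_sqdist\<close>). Hence
  \<open>ln (2 (1 - cos \<theta>))\<close> is \<open>ln D\<close>, with \<open>D = |u - u'|\<^sup>2\<close>, plus \<open>\<kappa>(x) + \<kappa>(y)\<close>, and it suffices to show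
  that the values of such an expression are dense in some interval: a compactness argument then
  fills the interval.

  Choose \<open>s\<close> between \<open>2d/3 + 1\<close> and the dimension of \<open>E\<close>. Frostman's lemma (\<open>frostman\<close>) gives a
  measure on \<open>E\<close> whose balls of radius \<open>r\<close> have mass \<open>O(r\<^sup>s)\<close>. The points seen from \<open>z\<close> within angle
  \<open>r\<close> of a given direction lie in \<open>O(1/r)\<close> balls of radius \<open>O(r)\<close> (\<open>cone_measure_le\<close>), so the image
  of the measure under \<open>u\<close> has exponent \<open>s - 1\<close>. As \<open>s - 1 > 2d/3 > (d + 1)/2 = n/2 + 1\<close>, which uses
  \<open>d > 3\<close>, the Riesz energy \<open>\<integral>\<integral> D\<^sup>-\<^sup>a\<close> is finite for some \<open>a\<close> with \<open>2a > n/2 + 1\<close> (\<open>energy_finite\<close>).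

  Let \<open>N\<close> be the law of \<open>ln D + \<kappa>(x) + \<kappa>(y)\<close> under the normalised weight \<open>D\<^sup>-\<^sup>a\<close>. Its characteristic
  function at \<open>t\<close> is a multiple of \<open>\<integral>\<integral> h(x) h(y) D\<^sup>-\<^sup>p\<close> with \<open>p = a - it\<close> and \<open>h = exp (it\<kappa>)\<close>; the
  two functions of one point are absorbed in the unimodular factor \<open>h\<close>. Euler's integral writes
  \<open>D\<^sup>-\<^sup>p\<close> as a superposition of the Gaussians \<open>exp (- e\<^sup>s D)\<close>, and the Fourier transform
  diagonalises all of them at once: \<open>D\<^sup>-\<^sup>p\<close> becomes a multiplier which is, in absolute value, a
  constant \<open>R\<close> times the nonnegative multiplier of \<open>D\<^sup>-\<^sup>a\<close>. So the double integral is at most \<open>R\<close>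
  times the energy, where \<open>R = |\<Gamma>(n/2 - p)| \<Gamma>(a) / (|\<Gamma>(p)| \<Gamma>(n/2 - a))\<close> (\<open>energy_Mellin_bound\<close>).
  This quotient is \<open>O(|t|\<^sup>-\<^sup>c)\<close> with \<open>c = 2a - n/2 > 1\<close> if \<open>a\<close> is chosen such that also \<open>c < 2\<close>
  (\<open>Gamma_ratio_bound\<close>). The characteristic function of \<open>N\<close> is therefore integrable, so \<open>N\<close> has a
  continuous density, which is positive on some interval
  (\<open>positive_on_interval_if_char_integrable\<close>).\<close>

section \<open>Frostman measures\<close>

lemma hausdorff_premeasure_Un_le:
  "hausdorff_premeasure s \<delta> (A \<union> B) \<le> hausdorff_premeasure s \<delta> A + hausdorff_premeasure s \<delta> B"
proof -
  define cov where "cov E = {U :: nat \<Rightarrow> 'a set. (\<forall>i. bounded (U i) \<and> diameter (U i) \<le> \<delta>) \<and> E \<subseteq> (\<Union>i. U i)}" for E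
  define W where "W U = (\<Sum>i. hausdorff_weight s (U i))" for U :: "nat \<Rightarrow> 'a set"
  have pre: "hausdorff_premeasure s \<delta> E = (INF U\<in>cov E. W U)" for E
    by (simp add: hausdorff_premeasure_def cov_def W_def)
  have "hausdorff_premeasure s \<delta> (A \<union> B) \<le> W U + W V" if U: "U \<in> cov A" and V: "V \<in> cov B" for U V
  proof -
    \<comment> \<open>Interleave a cover of \<open>A\<close> with a cover of \<open>B\<close>.\<close>
    define Z where "Z i = (if even i then U (i div 2) else V (i div 2))" for i
    have Z_ev: "Z (2 * i) = U i" and Z_od: "Z (Suc (2 * i)) = V i" for i
      by (simp_all add: Z_def)
    have "A \<union> B \<subseteq> (\<Union>i. Z i)"
    proof
      fix x assume "x \<in> A \<union> B"
      then consider i where "x \<in> U i" | i where "x \<in> V i"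
        using U V by (auto simp: cov_def)
      then show "x \<in> (\<Union>i. Z i)"
        by cases (metis UN_I UNIV_I Z_ev, metis UN_I UNIV_I Z_od)
    qed
    then have "Z \<in> cov (A \<union> B)"
      using U V by (auto simp: cov_def Z_def)
    then have "hausdorff_premeasure s \<delta> (A \<union> B) \<le> W Z"
      unfolding pre by (rule INF_lower)
    also have "W Z \<le> W U + W V"
      unfolding W_def
    proof (rule suminf_le_const)
      show "summable (\<lambda>i. hausdorff_weight s (Z i))" by simp
      fix N
      have "(\<Sum>i<N. hausdorff_weight s (Z i)) \<le> (\<Sum>i<2*N. hausdorff_weight s (Z i))"
        by (rule sum_mono2) auto
      also have "\<dots> = (\<Sum>i<N. hausdorff_weight s (U i)) + (\<Sum>i<N. hausdorff_weight s (V i))"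
      proof (induction N)
        case (Suc N)
        have "(\<Sum>i<2*Suc N. hausdorff_weight s (Z i)) = (\<Sum>i<Suc (Suc (2*N)). hausdorff_weight s (Z i))"
          by simp
        also have "\<dots> = (\<Sum>i<2*N. hausdorff_weight s (Z i)) + hausdorff_weight s (U N) + hausdorff_weight s (V N)"
          by (simp only: sum.lessThan_Suc Z_ev Z_od)
        finally show ?case unfolding Suc.IH by (simp add: ac_simps)
      qed simp
      also have "\<dots> \<le> (\<Sum>i. hausdorff_weight s (U i)) + (\<Sum>i. hausdorff_weight s (V i))"
        by (intro add_mono sum_le_suminf) auto
      finally show "(\<Sum>i<N. hausdorff_weight s (Z i)) \<le> \<dots>" .
    qed
    finally show ?thesis .
  qed
  note le = this
  show ?thesis
  proof (rule ennreal_le_epsilon)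
    fix e :: real
    assume fin: "hausdorff_premeasure s \<delta> A + hausdorff_premeasure s \<delta> B < top" and "0 < e"
    have finiteA: "(INF U\<in>cov A. W U) \<noteq> \<infinity>" and finiteB: "(INF V\<in>cov B. W V) \<noteq> \<infinity>"
      using fin unfolding pre
      unfolding ennreal_add_less_top infinity_ennreal_def by (metis less_irrefl)+
    have "\<exists>U\<in>cov A. W U < (INF U\<in>cov A. W U) + ennreal (e/2)"
      using finiteA \<open>0 < e\<close> by (intro INF_approx_ennreal[OF _ refl]) auto
    moreover have "\<exists>V\<in>cov B. W V < (INF V\<in>cov B. W V) + ennreal (e/2)"
      using finiteB \<open>0 < e\<close> by (intro INF_approx_ennreal[OF _ refl]) auto
    ultimately obtain U V where UV: "U \<in> cov A" "V \<in> cov B"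
      "W U \<le> hausdorff_premeasure s \<delta> A + ennreal (e/2)"
      "W V \<le> hausdorff_premeasure s \<delta> B + ennreal (e/2)"
      by (auto simp: pre less_imp_le)
    have "hausdorff_premeasure s \<delta> (A \<union> B) \<le> W U + W V"
      using UV by (intro le)
    also have "\<dots> \<le> (hausdorff_premeasure s \<delta> A + ennreal (e/2)) + (hausdorff_premeasure s \<delta> B + ennreal (e/2))"
      using UV by (intro add_mono)
    also have "\<dots> = hausdorff_premeasure s \<delta> A + hausdorff_premeasure s \<delta> B + (ennreal (e/2) + ennreal (e/2))"
      by (simp add: algebra_simps)
    also have "ennreal (e/2) + ennreal (e/2) = ennreal e"
      using \<open>0 < e\<close> by (simp flip: ennreal_plus)
    finally show "hausdorff_premeasure s \<delta> (A \<union> B) \<le>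
      hausdorff_premeasure s \<delta> A + hausdorff_premeasure s \<delta> B + ennreal e" .
  qed
qed

lemma hausdorff_premeasure_le_diameter:
  assumes "bounded A" "diameter A \<le> \<delta>" "0 < s" "0 \<le> \<delta>"
  shows "hausdorff_premeasure s \<delta> A \<le> ennreal (diameter A powr s)"
proof -
  define U where "U = (\<lambda>i::nat. if i = 0 then A else {})"
  have "hausdorff_premeasure s \<delta> A \<le> (\<Sum>i. hausdorff_weight s (U i))"
    unfolding hausdorff_premeasure_def using assms
    by (intro INF_lower) (auto simp: U_def)
  also have "\<dots> = (\<Sum>i\<in>{0}. hausdorff_weight s (U i))"
    by (rule suminf_finite) (auto simp: U_def hausdorff_weight_def)
  also have "\<dots> \<le> ennreal (diameter A powr s)"
    using assms by (auto simp: U_def hausdorff_weight_def)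
  finally show ?thesis .
qed

text \<open>A nonnegative additive weight on the nodes of the infinite binary tree is the mass of the
  nodes under a Borel map from an interval to the branches: the root gets the interval of length
  \<open>w []\<close> starting at \<open>0\<close>, and the interval of each node is split into that of its left child
  (\<open>False\<close>) followed by that of its right child. Nodes are lists of turns, the latest turn first;
  \<open>tree_left\<close> is the left end point of the interval of a node, and \<open>tree_path w m t\<close> the node of
  depth \<open>m\<close> whose interval contains \<open>t\<close>.\<close>

primrec tree_left :: "(bool list \<Rightarrow> real) \<Rightarrow> bool list \<Rightarrow> real" where
  "tree_left w [] = 0"
| "tree_left w (b # xs) = tree_left w xs + (if b then w (False # xs) else 0)"

primrec tree_path :: "(bool list \<Rightarrow> real) \<Rightarrow> nat \<Rightarrow> real \<Rightarrow> bool list" where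
  "tree_path w 0 t = []"
| "tree_path w (Suc m) t =
     (tree_left w (tree_path w m t) + w (False # tree_path w m t) \<le> t) # tree_path w m t"

lemma tree_path_eq_iff:
  assumes "\<And>xs. w xs = w (False # xs) + w (True # xs)" "\<And>xs. 0 \<le> w xs" "0 \<le> t" "t < w []"
  shows "tree_path w m t = xs \<longleftrightarrow> length xs = m \<and> tree_left w xs \<le> t \<and> t < tree_left w xs + w xs"
proof (induction m arbitrary: xs)
  case 0
  then show ?case using assms(3,4) by auto
next
  case (Suc m)
  show ?case
  proof (cases xs)
    case (Cons b ys)
    have "tree_path w (Suc m) t = xs \<longleftrightarrow> tree_path w m t = ys \<and> (tree_left w ys + w (False # ys) \<le> t) = b"
      using Cons by auto
    also have "\<dots> \<longleftrightarrow> length xs = Suc m \<and> tree_left w xs \<le> t \<and> t < tree_left w xs + w xs"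
      unfolding Suc.IH using Cons assms(1)[of ys] assms(2)[of "False # ys"] assms(2)[of "True # ys"]
      by (cases b) auto
    finally show ?thesis .
  qed auto
qed

lemma length_tree_path [simp]: "length (tree_path w m t) = m"
  by (induction m) auto

text \<open>Frostman's lemma for any finitely subadditive content that is bounded by a power of the
  diameter. Cut \<open>E\<close> repeatedly in two by reading off the binary digits of the coordinates in turn,
  and let every piece pass on its mass to its two halves in proportion to their contents. By
  subadditivity no piece ever gets more mass than its content. Binary expansion along the resulting
  tree turns Lebesgue measure on an interval into the required measure. A ball of radius \<open>r\<close> meets
  boundedly many pieces of diameter comparable to \<open>r\<close>, and each has mass \<open>O(r\<^sup>s)\<close>.\<close>

lemma frostman_of_content:
  fixes E :: "(real^'n) set" and M :: "(real^'n) set \<Rightarrow> real"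
  assumes E: "compact E" and s: "0 < s" and \<delta>: "0 < \<delta>"
    and M_nonneg: "\<And>A. 0 \<le> M A"
    and M_Un: "\<And>A B. M (A \<union> B) \<le> M A + M B"
    and M_diam: "\<And>A. A \<subseteq> E \<Longrightarrow> diameter A \<le> \<delta> \<Longrightarrow> M A \<le> diameter A powr s"
    and M_pos: "0 < M E"
  obtains \<mu> :: "(real^'n) measure" and C where
    "finite_measure \<mu>" "sets \<mu> = sets borel" "AE x in \<mu>. x \<in> E" "0 < measure \<mu> UNIV"
    "0 < C" "\<And>x r. 0 < r \<Longrightarrow> measure \<mu> (cball x r) \<le> C * r powr s"
proof -
  define d where "d = CARD('n)"
  have d: "0 < d" by (simp add: d_def)
  obtain e :: "nat \<Rightarrow> 'n" where e: "bij_betw e {0..<d} UNIV"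
    using ex_bij_betw_nat_finite[of "UNIV :: 'n set"] by (auto simp: d_def)
  obtain B where B: "\<And>x. x \<in> E \<Longrightarrow> norm x \<le> B"
    using compact_imp_bounded[OF E] by (auto simp: bounded_iff)
  define L where "L = \<bar>B\<bar> + 1"
  have L: "0 < L" by (simp add: L_def)
  have EL: "\<bar>x $ i\<bar> < L" if "x \<in> E" for x i
    using B[OF that] component_le_norm_cart[of x i] by (simp add: L_def)
  \<comment> \<open>Knowing \<open>q j x\<close> means knowing the first \<open>j\<close> binary digits of \<open>x/L\<close>. Since \<open>q 0 x i\<close> is \<open>-1\<close> or
    \<open>0\<close>, the parities of \<open>q 0 x i, ..., q j x i\<close> determine \<open>q j x i\<close>.\<close>
  define q :: "nat \<Rightarrow> real^'n \<Rightarrow> 'n \<Rightarrow> int" where "q j x i = \<lfloor>2^j * (x$i) / L\<rfloor>" for j x i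
  define bit where "bit m x = odd (q (m div d) x (e (m mod d)))" for m x
  \<comment> \<open>The piece of \<open>E\<close> belonging to a node; the rounds of \<open>d\<close> digits treat every coordinate once.\<close>
  define S where "S xs = {x\<in>E. \<forall>m<length xs. rev xs ! m = bit m x}" for xs
  have S_Nil: "S [] = E" by (simp add: S_def)
  have S_Cons: "S (b # xs) = {x \<in> S xs. bit (length xs) x = b}" for b xs
    by (auto simp: S_def nth_append less_Suc_eq)
  have S_E: "S xs \<subseteq> E" for xs by (auto simp: S_def)
  have S_split: "S xs = S (False # xs) \<union> S (True # xs)" for xs
    by (auto simp: S_Cons)
  \<comment> \<open>If both halves have content \<open>0\<close>, then so has the piece, and \<open>0/0 = 0\<close> is the right value.\<close>
  define w where "w = rec_list (M E)
     (\<lambda>b xs r. r * M (S (b # xs)) / (M (S (False # xs)) + M (S (True # xs))))"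
  have w_Nil: "w [] = M E" by (simp add: w_def)
  have w_Cons: "w (b # xs) = w xs * M (S (b # xs)) / (M (S (False # xs)) + M (S (True # xs)))" for b xs
    by (simp add: w_def)
  have w_nonneg: "0 \<le> w xs" for xs
    by (induction xs) (auto simp: w_Nil w_Cons M_nonneg add_nonneg_nonneg)
  have w_le: "w xs \<le> M (S xs)" for xs
  proof (induction xs)
    case (Cons b xs)
    define D where "D = M (S (False # xs)) + M (S (True # xs))"
    have D: "0 \<le> D" "w xs \<le> D"
      using Cons M_Un[of "S (False # xs)" "S (True # xs)"] S_split[of xs] by (auto simp: D_def M_nonneg)
    have "w (b # xs) = M (S (b # xs)) * (w xs / D)" by (simp add: w_Cons D_def)
    also have "\<dots> \<le> M (S (b # xs)) * 1"
      using D by (intro mult_left_mono) (auto simp: M_nonneg divide_le_eq)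
    finally show ?case by simp
  qed (simp add: w_Nil S_Nil)
  have w_split: "w xs = w (False # xs) + w (True # xs)" for xs
  proof -
    define D where "D = M (S (False # xs)) + M (S (True # xs))"
    have "w xs \<le> D"
      using w_le[of xs] M_Un[of "S (False # xs)" "S (True # xs)"] S_split[of xs] by (auto simp: D_def)
    then have "D = 0 \<longrightarrow> w xs = 0" using w_nonneg[of xs] by auto
    moreover have "w (False # xs) + w (True # xs) = w xs * (D / D)"
      unfolding w_Cons unfolding D_def[symmetric]
      by (simp only: add_divide_distrib[symmetric] ring_distribs(1)[symmetric] D_def[symmetric] times_divide_eq_right)
    ultimately show ?thesis by auto
  qed
  define T where "T = {0..<M E}"
  define path where "path = tree_path w"
  have path_iff: "path m t = xs \<longleftrightarrow> length xs = m \<and> tree_left w xs \<le> t \<and> t < tree_left w xs + w xs"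
    if "t \<in> T" for m t xs
    unfolding path_def using that
    by (intro tree_path_eq_iff[OF w_split w_nonneg]) (auto simp: T_def w_Nil)
  have length_path: "length (path m t) = m" for m t by (simp add: path_def)
  have S_path_ne: "S (path m t) \<noteq> {}" if "t \<in> T" for m t
  proof
    assume "S (path m t) = {}"
    then have "w (path m t) \<le> 0"
      using w_le[of "path m t"] M_diam[of "{}"] \<delta> by simp
    then show False using path_iff[OF that, of m "path m t"] by auto
  qed
  have S_path_mono: "S (path (m + k) t) \<subseteq> S (path m t)" for m k t
    by (induction k) (auto simp: path_def S_Cons)

  have q_Suc: "q (Suc j) x i div 2 = q j x i" for j x i
  proof -
    have "q j x i = \<lfloor>(2^Suc j * (x$i) / L) / real_of_int 2\<rfloor>" by (simp add: q_def)
    also have "\<dots> = q (Suc j) x i div 2"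
      unfolding q_def by (rule floor_divide_real_eq_div) simp
    finally show ?thesis ..
  qed
  have q_0: "q 0 x i = -1 \<or> q 0 x i = 0" if "x \<in> E" for x i
  proof -
    have "-1 \<le> x $ i / L" "x $ i / L < 1"
      using EL[OF that, of i] L by (auto simp: field_simps abs_less_iff)
    then have "-1 \<le> q 0 x i" "q 0 x i < 1" by (auto simp: q_def le_floor_iff floor_less_iff)
    then show ?thesis by linarith
  qed
  have q_eq: "q j x i = q j y i"
    if xy: "x \<in> E" "y \<in> E" and bits: "\<And>m. m < Suc J * d \<Longrightarrow> bit m x = bit m y" and "j \<le> J" for J j x y i
    using \<open>j \<le> J\<close>
  proof (induction j)
    case (0)
    obtain k where k: "k < d" "e k = i" using e by (metis UNIV_I atLeastLessThan_iff bij_betw_iff_bijections)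
    have "odd (q 0 x i) = odd (q 0 y i)"
      using bits[of k] k d by (simp add: bit_def)
    then show ?case using q_0[OF xy(1), of i] q_0[OF xy(2), of i] by auto
  next
    case (Suc j)
    obtain k where k: "k < d" "e k = i" using e by (metis UNIV_I atLeastLessThan_iff bij_betw_iff_bijections)
    have "Suc j * d + k < Suc j * d + d" using k by simp
    also have "\<dots> \<le> Suc J * d" using Suc.prems by (metis add.commute mult_Suc mult_le_mono1 Suc_le_mono)
    finally have "bit (Suc j * d + k) x = bit (Suc j * d + k) y" by (rule bits)
    moreover have "(Suc j * d + k) div d = Suc j" "(Suc j * d + k) mod d = k"
      using k d by (simp_all del: mult_Suc)
    ultimately have "odd (q (Suc j) x i) = odd (q (Suc j) y i)"
      using k by (simp only: bit_def)
    moreover have "q (Suc j) x i div 2 = q (Suc j) y i div 2"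
      using Suc by (simp add: q_Suc)
    ultimately show ?case by presburger
  qed
  define rad where "rad J = real d * (L / 2^J)" for J
  have S_dist: "dist x y \<le> rad J" if xs: "length xs = Suc J * d" and xy: "x \<in> S xs" "y \<in> S xs" for x y xs J
  proof -
    have "\<bar>(x - y) $ i\<bar> \<le> L / 2^J" for i
    proof -
      have "q J x i = q J y i" using xy xs by (intro q_eq[of x y J]) (auto simp: S_def)
      then have "\<bar>2^J * (x$i) / L - 2^J * (y$i) / L\<bar> \<le> 1" unfolding q_def by linarith
      then show ?thesis using L by (simp add: field_simps abs_le_iff)
    qed
    then have "norm (x - y) \<le> (\<Sum>i\<in>(UNIV::'n set). L / 2^J)"
      by (intro order_trans[OF norm_le_l1_cart] sum_mono) auto
    then show ?thesis by (simp add: dist_norm d_def rad_def)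
  qed
  define \<xi> where "\<xi> m t = (SOME x. x \<in> S (path m t))" for m t
  have \<xi>: "\<xi> m t \<in> S (path m t)" if "t \<in> T" for m t
    using S_path_ne[OF that, of m] unfolding \<xi>_def by (meson ex_in_conv someI_ex)
  have \<xi>_E: "\<xi> m t \<in> E" if "t \<in> T" for m t using \<xi>[OF that, of m] S_E by auto
  have \<xi>_dist: "dist (\<xi> m t) (\<xi> (Suc J * d) t) \<le> rad J"
    if "t \<in> T" "Suc J * d \<le> m" for t m J
  proof -
    have "\<xi> m t \<in> S (path (Suc J * d) t)"
      using \<xi>[OF that(1), of m] S_path_mono[of "Suc J * d" "m - Suc J * d" t] that(2) by auto
    then show ?thesis using \<xi>[OF that(1)] by (intro S_dist[of "path (Suc J * d) t"]) (auto simp: length_path)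
  qed
  have small: "\<exists>J. rad J < \<epsilon>" if "0 < \<epsilon>" for \<epsilon> :: real
  proof -
    have "(\<lambda>J. rad J) \<longlonglongrightarrow> real d * 0"
      unfolding rad_def by (intro tendsto_intros LIMSEQ_divide_realpow_zero) auto
    then have "eventually (\<lambda>J. rad J < \<epsilon>) sequentially"
      using that by (auto simp: order_tendsto_iff)
    then show ?thesis by (auto simp: eventually_sequentially)
  qed
  \<comment> \<open>The pieces along a branch shrink to a point of the closed set \<open>E\<close>.\<close>
  define \<phi> where "\<phi> t = lim (\<lambda>m. \<xi> m t)" for t
  have \<phi>: "(\<lambda>m. \<xi> m t) \<longlonglongrightarrow> \<phi> t" if t: "t \<in> T" for t
  proof -
    have "Cauchy (\<lambda>m. \<xi> m t)"
    proof (rule metric_CauchyI)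
      fix \<epsilon> :: real assume "0 < \<epsilon>"
      then obtain J where J: "rad J < \<epsilon>/2" using small[of "\<epsilon>/2"] by auto
      have "dist (\<xi> m t) (\<xi> k t) < \<epsilon>" if "m \<ge> Suc J * d" "k \<ge> Suc J * d" for m k
        using \<xi>_dist[OF t that(1)] \<xi>_dist[OF t that(2)] J
          dist_triangle2[of "\<xi> m t" "\<xi> k t" "\<xi> (Suc J * d) t"] by linarith
      then show "\<exists>N. \<forall>m\<ge>N. \<forall>k\<ge>N. dist (\<xi> m t) (\<xi> k t) < \<epsilon>" by blast
    qed
    then show ?thesis unfolding \<phi>_def by (simp add: Cauchy_convergent_iff convergent_LIMSEQ_iff)
  qed
  have \<phi>_E: "\<phi> t \<in> E" if "t \<in> T" for t
    using closed_sequentially[OF compact_imp_closed[OF E] _ \<phi>[OF that]] \<xi>_E[OF that] by auto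
  have \<phi>_dist: "dist (\<phi> t) (\<xi> (Suc J * d) t) \<le> rad J" if "t \<in> T" for t J
  proof (rule Lim_bounded)
    show "(\<lambda>m. dist (\<xi> m t) (\<xi> (Suc J * d) t)) \<longlonglongrightarrow> dist (\<phi> t) (\<xi> (Suc J * d) t)"
      by (intro tendsto_intros \<phi> that)
    show "\<forall>m\<ge>Suc J * d. dist (\<xi> m t) (\<xi> (Suc J * d) t) \<le> rad J"
      using \<xi>_dist[OF that] by blast
  qed
  define N where "N = restrict_space lborel T"
  have T_sets [measurable]: "T \<in> sets lborel" by (simp add: T_def)
  have space_N: "space N = T" by (simp add: N_def space_restrict_space)
  have path_vimage: "{t \<in> T. path m t = xs} =
    (if length xs = m then T \<inter> {tree_left w xs ..< tree_left w xs + w xs} else {})" for m xs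
    using path_iff by auto
  have path_sets: "{t \<in> T. path m t = xs} \<in> sets N" for m xs
    unfolding path_vimage by (auto simp: N_def sets_restrict_space T_def)
  have path_emeasure: "emeasure N {t \<in> T. path m t = xs} \<le> ennreal (w xs)" for m xs
  proof -
    have "emeasure N {t \<in> T. path m t = xs} = emeasure lborel {t \<in> T. path m t = xs}"
      unfolding N_def by (rule emeasure_restrict_space) (auto simp: T_def)
    also have "\<dots> \<le> emeasure lborel {tree_left w xs ..< tree_left w xs + w xs}"
      unfolding path_vimage by (intro emeasure_mono) auto
    also have "\<dots> = ennreal (w xs)" using w_nonneg[of xs] by simp
    finally show ?thesis .
  qed
  have path_meas: "path m \<in> N \<rightarrow>\<^sub>M count_space UNIV" for m
  proof (subst measurable_count_space_eq2_countable, safe)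
    fix xs
    have "path m -` {xs} \<inter> space N = {t \<in> T. path m t = xs}" by (auto simp: space_N)
    then show "path m -` {xs} \<inter> space N \<in> sets N" using path_sets by simp
  qed auto
  have \<xi>_meas: "\<xi> m \<in> borel_measurable N" for m
    unfolding \<xi>_def by (rule measurable_compose[OF path_meas]) simp
  have \<phi>_meas [measurable]: "\<phi> \<in> borel_measurable N"
    by (rule borel_measurable_LIMSEQ_metric[of \<xi>, OF \<xi>_meas]) (simp add: space_N \<phi>)
  define \<mu> where "\<mu> = distr N borel \<phi>"
  have em_N: "emeasure N (space N) = ennreal (M E)"
    using M_nonneg[of E] by (simp add: N_def space_restrict_space emeasure_restrict_space T_def)
  interpret N: finite_measure N by standard (simp add: em_N)
  have fin: "finite_measure \<mu>"
    unfolding \<mu>_def by (rule N.finite_measure_distr) simp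
  have total: "measure \<mu> UNIV = M E"
    using em_N M_nonneg by (simp add: \<mu>_def measure_distr) (simp add: measure_def)
  interpret mu: finite_measure \<mu> by fact
  \<comment> \<open>Radii above \<open>r0\<close> only affect the constant.\<close>
  define r0 where "r0 = min (L/2) (\<delta> / d)"
  have r0: "0 < r0" using L d \<delta> by (simp add: r0_def)
  define P where "P = real ((4 * d + 7) ^ d)"
  define C where "C = max (M E / r0 powr s) (P * d powr s)"
  have Cpos: "0 < C" using M_pos r0 by (simp add: C_def less_max_iff_disj)
  have ball: "measure \<mu> (cball x r) \<le> C * r powr s" if r: "0 < r" for x r
  proof (cases "r0 \<le> r")
    case True
    have "measure \<mu> (cball x r) \<le> M E" 
      using mu.finite_measure_mono[of "cball x r" UNIV] unfolding total by (simp add: \<mu>_def)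
    also have "\<dots> = M E / r0 powr s * r0 powr s" using r0 by simp
    also have "\<dots> \<le> C * r powr s"
      using True r0 s Cpos by (intro mult_mono powr_mono2) (auto simp: C_def)
    finally show ?thesis .
  next
    case False
    define J where "J = (LEAST J. L / 2^J \<le> r)"
    have "\<exists>J. L / 2^J \<le> r"
    proof -
      obtain J where "rad J < r" using small[OF r] by auto
      moreover have "1 * (L / 2^J) \<le> rad J" unfolding rad_def using d L by (intro mult_right_mono) auto
      ultimately show ?thesis by (intro exI[of _ J]) linarith
    qed
    then have J1: "L / 2^J \<le> r" unfolding J_def by (rule LeastI_ex)
    have "r < L / 2" "r < \<delta> / d" using False by (simp_all add: r0_def)
    then have "J \<noteq> 0" using J1 L by (intro notI) simp
    then have "\<not> L / 2^(J - 1) \<le> r" unfolding J_def by (intro not_less_Least) auto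
    moreover have "(2::real)^J = 2 * 2^(J-1)" using \<open>J \<noteq> 0\<close> by (cases J) auto
    ultimately have J2: "r * 2^J / L < 2" using L by (simp add: field_simps)
    have dr: "rad J \<le> d * r" unfolding rad_def using J1 by (intro mult_left_mono) auto
    have dr_\<delta>: "d * r \<le> \<delta>" using \<open>r < \<delta> / d\<close> d by (simp add: field_simps)
    \<comment> \<open>The digit vectors that points of pieces meeting the ball can have; \<open>F\<close> recovers the node from its
      digit vector.\<close>
    define K where "K = PiE UNIV (\<lambda>i. {q J x i - (2 * int d + 3) .. q J x i + (2 * int d + 3)})"
    define F where "F k = rev (map (\<lambda>m. odd (k (e (m mod d)) div 2^(J - m div d))) [0..<Suc J * d])" for k :: "'n \<Rightarrow> int"
    have finK: "finite K" unfolding K_def by (intro finite_PiE) auto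
    have cardK: "real (card K) = P"
      unfolding K_def P_def by (subst card_PiE) (auto simp: d_def algebra_simps nat_add_distrib nat_mult_distrib)
    have q_div: "q j y i = q J y i div 2^(J - j)" if "j \<le> J" for j y i
    proof -
      have "2^J = 2^j * (2::real)^(J - j)" using that by (simp flip: power_add)
      then have "q j y i = \<lfloor>(2^J * (y$i) / L) / real_of_int (2^(J - j))\<rfloor>" by (simp add: q_def)
      also have "\<dots> = q J y i div 2^(J - j)" unfolding q_def by (rule floor_divide_real_eq_div) simp
      finally show ?thesis .
    qed
    have sub: "{t \<in> T. \<phi> t \<in> cball x r} \<subseteq> (\<Union>k\<in>K. {t \<in> T. path (Suc J * d) t = F k})"
    proof safe
      fix t assume t: "t \<in> T" and "\<phi> t \<in> cball x r"
      define y where "y = \<xi> (Suc J * d) t"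
      have "dist x y \<le> r + rad J"
        using \<phi>_dist[OF t, of J] \<open>\<phi> t \<in> cball x r\<close> dist_triangle[of x y "\<phi> t"] by (simp add: y_def)
      also have "\<dots> \<le> (d + 1) * r" using dr by (simp add: algebra_simps)
      finally have xy: "dist x y \<le> (d + 1) * r" .
      have "q J y \<in> K" unfolding K_def
      proof (intro PiE_I)
        fix i
        have "\<bar>(y - x) $ i\<bar> \<le> (d + 1) * r"
          using xy component_le_norm_cart[of "y - x" i] by (simp add: dist_norm norm_minus_commute)
        then have "\<bar>(y - x) $ i\<bar> * (2^J / L) \<le> (d + 1) * r * (2^J / L)"
          using L by (intro mult_right_mono) auto
        also have "\<bar>(y - x) $ i\<bar> * (2^J / L) = \<bar>((y - x) $ i) * (2^J / L)\<bar>"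
          using L by (simp add: abs_mult)
        also have "((y - x) $ i) * (2^J / L) = 2^J * (y$i) / L - 2^J * (x$i) / L"
          by (simp add: algebra_simps diff_divide_distrib)
        also have "(d + 1) * r * (2^J / L) = (d + 1) * (r * 2^J / L)" by simp
        finally have "\<bar>2^J * (y$i) / L - 2^J * (x$i) / L\<bar> \<le> (d + 1) * (r * 2^J / L)" .
        also have "\<dots> \<le> real (d + 1) * 2" using J2 by (intro mult_left_mono) auto
        finally have "\<bar>2^J * (y$i) / L - 2^J * (x$i) / L\<bar> \<le> real_of_int (2 * int d + 2)" by simp
        then show "q J y i \<in> {q J x i - (2 * int d + 3) .. q J x i + (2 * int d + 3)}"
          unfolding q_def by (auto; linarith)
      qed auto
      moreover have "path (Suc J * d) t = F (q J y)"
      proof -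
        have "y \<in> S (path (Suc J * d) t)" unfolding y_def by (rule \<xi>[OF t])
        then have bits: "rev (path (Suc J * d) t) ! m = bit m y" if "m < Suc J * d" for m
          using that by (simp add: S_def length_path)
        have "rev (path (Suc J * d) t) = rev (F (q J y))"
        proof (rule nth_equalityI)
          fix m assume "m < length (rev (path (Suc J * d) t))"
          then have m: "m < Suc J * d" by (simp add: length_path)
          then have "m div d \<le> J" using d by (simp add: less_mult_imp_div_less flip: less_Suc_eq_le)
          then show "rev (path (Suc J * d) t) ! m = rev (F (q J y)) ! m"
            unfolding bits[OF m] using m q_div[of "m div d" y "e (m mod d)"] 
            by (simp add: F_def bit_def del: upt_Suc mult_Suc)
        qed (simp add: length_path F_def)
        then show ?thesis by simp
      qed
      ultimately show "t \<in> (\<Union>k\<in>K. {t \<in> T. path (Suc J * d) t = F k})" using t by auto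
    qed
    have wF: "w (F k) \<le> d powr s * r powr s" for k
    proof -
      have "diameter (S (F k)) \<le> rad J"
        using L by (intro diameter_le) (auto simp: rad_def[symmetric] F_def simp flip: dist_norm simp del: mult_Suc intro!: S_dist, simp add: rad_def)
      then have "diameter (S (F k)) \<le> d * r" using dr by linarith
      then have "M (S (F k)) \<le> diameter (S (F k)) powr s"
        using dr_\<delta> S_E by (intro M_diam) auto
      also have "\<dots> \<le> (d * r) powr s"
        using \<open>diameter (S (F k)) \<le> d * r\<close> s S_E compact_imp_bounded[OF E]
        by (intro powr_mono2 diameter_ge_0) (auto intro: bounded_subset)
      also have "\<dots> = d powr s * r powr s" using r by (simp add: powr_mult)
      finally show ?thesis using w_le[of "F k"] by linarith
    qed
    have "emeasure \<mu> (cball x r) = emeasure N {t \<in> T. \<phi> t \<in> cball x r}"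
      unfolding \<mu>_def by (subst emeasure_distr) (auto simp: space_N intro!: arg_cong[where f = "emeasure N"])
    also have "\<dots> \<le> emeasure N (\<Union>k\<in>K. {t \<in> T. path (Suc J * d) t = F k})"
      using finK path_sets by (intro emeasure_mono sub sets.finite_UN) auto
    also have "\<dots> \<le> (\<Sum>k\<in>K. emeasure N {t \<in> T. path (Suc J * d) t = F k})"
      using finK path_sets by (intro emeasure_subadditive_finite) auto
    also have "\<dots> \<le> (\<Sum>k\<in>K. ennreal (d powr s * r powr s))"
      using path_emeasure wF by (intro sum_mono) (meson ennreal_leI order_trans)
    also have "\<dots> = ennreal (P * (d powr s * r powr s))"
      unfolding sum_constant cardK[symmetric] by (simp add: ennreal_mult flip: ennreal_of_nat_eq_real_of_nat)
    finally have "measure \<mu> (cball x r) \<le> P * (d powr s * r powr s)"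
      by (simp add: mu.emeasure_eq_measure P_def)
    also have "\<dots> \<le> C * r powr s"
      unfolding mult.assoc[symmetric] by (intro mult_right_mono) (auto simp: C_def)
    finally show ?thesis .
  qed
  have "AE x in \<mu>. x \<in> E"
    unfolding \<mu>_def using compact_imp_closed[OF E] \<phi>_E
    by (subst AE_distr_iff) (auto simp: space_N)
  then show thesis
    using that[of \<mu> C] fin total M_pos Cpos ball by (simp add: \<mu>_def)
qed

text \<open>The premeasure \<open>H\<^sub>s\<^sub>,\<^sub>\<delta>\<close> for one \<open>\<delta>\<close> that gives \<open>E\<close> positive mass is a suitable content. It is
  cut off at \<open>1\<close> only to be real-valued.\<close>

lemma frostman:
  fixes E :: "(real^'n) set"
  assumes E: "compact E" and s: "0 < s" and pos: "hausdorff_measure s E \<noteq> 0"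
  obtains \<mu> :: "(real^'n) measure" and C where
    "finite_measure \<mu>" "sets \<mu> = sets borel" "AE x in \<mu>. x \<in> E" "0 < measure \<mu> UNIV"
    "0 < C" "\<And>x r. 0 < r \<Longrightarrow> measure \<mu> (cball x r) \<le> C * r powr s"
proof -
  obtain \<delta> where \<delta>: "0 < \<delta>" "hausdorff_premeasure s \<delta> E \<noteq> 0"
    using pos unfolding hausdorff_measure_def
    by (metis (mono_tags, lifting) SUP_bot_conv(2) bot_ennreal greaterThan_iff)
  define M where "M A = enn2real (min (hausdorff_premeasure s \<delta> A) 1)" for A :: "(real^'n) set"
  have fin: "min (hausdorff_premeasure s \<delta> A) 1 < top" for A :: "(real^'n) set"
    by (simp add: min_less_iff_disj)
  have M: "ennreal (M A) = min (hausdorff_premeasure s \<delta> A) 1" for A :: "(real^'n) set"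
    unfolding M_def using fin[of A] by simp
  have M_nonneg: "0 \<le> M A" for A by (simp add: M_def)
  show thesis
  proof (rule frostman_of_content[of E s \<delta> M])
    show "M (A \<union> B) \<le> M A + M B" for A B
    proof -
      have "ennreal (M (A \<union> B)) \<le> min (hausdorff_premeasure s \<delta> A + hausdorff_premeasure s \<delta> B) 1"
        unfolding M using hausdorff_premeasure_Un_le[of s \<delta> A B] by (intro min.mono) auto
      also have "\<dots> \<le> min (hausdorff_premeasure s \<delta> A) 1 + min (hausdorff_premeasure s \<delta> B) 1"
      proof -
        have "min (a + b) 1 \<le> min a 1 + min b 1" for a b :: ennreal
        proof (cases "1 \<le> a \<or> 1 \<le> b")
          case True
          then have "1 \<le> min a 1 + min b 1"
            by (auto simp: min_absorb2 intro: add_increasing add_increasing2)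
          then show ?thesis using min.coboundedI2 by blast
        next
          case False
          then show ?thesis by (simp add: min_absorb1 less_imp_le not_le)
        qed
        then show ?thesis .
      qed
      also have "\<dots> = ennreal (M A + M B)" by (subst ennreal_plus) (simp_all only: M M_nonneg)
      finally show ?thesis
        by (subst (asm) ennreal_le_iff) (simp_all only: M_nonneg add_nonneg_nonneg)
    qed
    show "M A \<le> diameter A powr s" if "A \<subseteq> E" "diameter A \<le> \<delta>" for A
    proof -
      have "bounded A" using that E compact_imp_bounded bounded_subset by blast
      then have "ennreal (M A) \<le> ennreal (diameter A powr s)"
        unfolding M using hausdorff_premeasure_le_diameter[of A \<delta> s] that \<delta> s
        by (intro min.coboundedI1) auto
      then show ?thesis by simp
    qed
    have "0 < ennreal (M E)" unfolding M using \<delta> by (simp add: min_def zero_less_iff_neq_zero)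
    then show "0 < M E" by simp
  qed (use E s \<delta> that M_nonneg in auto)
qed

section \<open>Decay of Gamma quotients along vertical lines\<close>

text \<open>\<open>ln |1 + h|\<close> is linear in \<open>h\<close> up to a quadratic error, so \<open>ln |1 + \<epsilon>h|\<close> exceeds \<open>\<epsilon> ln |1 + h|\<close>
  at most by a multiple of \<open>|h|\<^sup>2\<close>. With \<open>h = 1/(z + k)\<close> these errors are summable over \<open>k\<close>.\<close>

lemma norm_one_plus_mult_le:
  fixes h :: complex and \<epsilon> q :: real
  assumes h: "0 \<le> Re h" "norm h \<le> 1 / q" and q: "0 < q" and \<epsilon>: "0 < \<epsilon>" "\<epsilon> < 1"
  shows "norm (1 + of_real \<epsilon> * h) \<le> norm (1 + h) powr \<epsilon> * exp (norm h ^ 2 * (2 + 1/q)^2)"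
proof -
  \<comment> \<open>\<open>|1 + h|\<^sup>2 = 1 + x\<close>\<close>
  define x where "x = 2 * Re h + norm h ^ 2"
  have x: "0 \<le> x" using h by (simp add: x_def)
  have nh: "norm h ^ 2 = Re h ^ 2 + Im h ^ 2" by (simp add: cmod_power2)
  have "x \<le> norm h * (2 + 1/q)"
  proof -
    have "x \<le> 2 * norm h + norm h * norm h"
      using complex_Re_le_cmod[of h] by (simp add: x_def power2_eq_square)
    also have "\<dots> \<le> 2 * norm h + norm h * (1/q)"
      using h by (intro add_left_mono mult_left_mono) auto
    finally show ?thesis by (simp add: algebra_simps)
  qed
  then have x2: "x^2 \<le> norm h ^ 2 * (2 + 1/q)^2"
    using x unfolding power_mult_distrib[symmetric] by (intro power_mono)
  have n1: "norm (1 + h) ^ 2 = 1 + x"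
    unfolding x_def nh cmod_power2 by (simp add: power2_eq_square algebra_simps)
  have "norm (1 + of_real \<epsilon> * h) ^ 2 = 1 + (2 * \<epsilon> * Re h + \<epsilon>^2 * norm h ^ 2)"
    unfolding nh cmod_power2 by (simp add: power2_eq_square algebra_simps)
  also have "\<dots> \<le> 1 + \<epsilon> * x"
  proof -
    have "\<epsilon>^2 * norm h ^ 2 \<le> \<epsilon> * norm h ^ 2"
      using \<epsilon> by (intro mult_right_mono) (auto simp: power2_eq_square mult_left_le)
    then show ?thesis by (simp add: x_def algebra_simps)
  qed
  also have "\<dots> \<le> exp (\<epsilon> * x)" by (rule exp_ge_add_one_self)
  also have "\<dots> \<le> exp (\<epsilon> * (ln (1 + x) + x^2))"
  proof -
    have "x \<le> ln (1 + x) + x^2"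
    proof (cases "x \<le> 1")
      case True
      then show ?thesis using ln_one_plus_pos_lower_bound[OF x] by simp
    next
      case False
      then have "1 * x \<le> x * x" by (intro mult_right_mono) auto
      moreover have "0 \<le> ln (1 + x)" using x by simp
      ultimately show ?thesis by (simp add: power2_eq_square)
    qed
    then show ?thesis using \<epsilon> by simp
  qed
  also have "\<dots> \<le> exp (\<epsilon> * ln (1 + x) + x^2)"
    using \<epsilon> by (simp add: distrib_left mult_left_le_one_le)
  also have "\<dots> \<le> exp (\<epsilon> * ln (1 + x)) * exp (norm h ^ 2 * (2 + 1/q)^2)"
    using x2 by (simp add: exp_add)
  also have "exp (\<epsilon> * ln (1 + x)) = (norm (1 + h) powr \<epsilon>)^2"
  proof -
    have "0 < norm (1 + h)" using h by (auto simp: complex_eq_iff)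
    then have "(norm (1 + h) powr \<epsilon>)^2 = (norm (1 + h)^2) powr \<epsilon>"
      by (simp add: power2_eq_square powr_mult)
    then show ?thesis using x unfolding n1 by (simp add: powr_def)
  qed
  also have "\<dots> * exp (norm h ^ 2 * (2 + 1/q)^2) \<le> (norm (1 + h) powr \<epsilon> * exp (norm h ^ 2 * (2 + 1/q)^2))^2"
    unfolding power_mult_distrib by (intro mult_left_mono self_le_power) auto
  finally show ?thesis by (rule power2_le_imp_le) simp
qed

text \<open>Multiply the preceding estimate over the factors \<open>z + k\<close>; the products of
  \<open>|z + k + 1| / |z + k|\<close> telescope.\<close>

lemma pochhammer_shift_le:
  fixes z :: complex and \<epsilon> :: real
  assumes q: "0 < Re z" and \<epsilon>: "0 < \<epsilon>" "\<epsilon> < 1"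
  shows "norm (pochhammer (z + of_real \<epsilon>) n) \<le>
    norm (pochhammer z n) * (norm (z + of_nat n) / norm z) powr \<epsilon> *
    exp ((\<Sum>k<n. 1 / (Re z + real k)^2) * (2 + 1/Re z)^2)"
proof (induction n)
  case 0
  have "z \<noteq> 0" using q by auto
  then show ?case by simp
next
  case (Suc n)
  define B where "B = (2 + 1/Re z)^2"
  define w where "w = z + of_nat n"
  define h where "h = 1 / w"
  have w: "Re z + n \<le> norm w" "0 < Re w" using q complex_Re_le_cmod[of w] by (auto simp: w_def)
  then have w0: "0 < norm w" and wne: "w \<noteq> 0" using q by auto
  have nh: "norm h \<le> 1 / (Re z + n)"
    using w q by (auto simp: h_def norm_divide intro!: divide_left_mono mult_pos_pos)
  also have "\<dots> \<le> 1 / Re z" using q by (intro divide_left_mono) auto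
  finally have nh2: "norm h \<le> 1 / Re z" .
  have Reh: "0 \<le> Re h" using w by (simp add: h_def Re_divide)
  have nh_sq: "norm h ^ 2 \<le> 1 / (Re z + real n)^2"
    using power_mono[OF nh, of 2] by (simp add: power_divide)
  have "norm (w + of_real \<epsilon>) = norm w * norm (1 + of_real \<epsilon> * h)"
    unfolding norm_mult[symmetric] using wne by (simp add: h_def algebra_simps)
  also have "\<dots> \<le> norm w * (norm (1 + h) powr \<epsilon> * exp (norm h ^ 2 * B))"
    unfolding B_def by (intro mult_left_mono norm_one_plus_mult_le Reh nh2 q \<epsilon>) simp
  also have "\<dots> \<le> norm w * (norm (1 + h) powr \<epsilon> * exp (1 / (Re z + real n)^2 * B))"
    using mult_right_mono[OF nh_sq, of B] by (intro mult_left_mono) (auto simp: B_def)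
  also have "norm (1 + h) = norm (w + 1) / norm w"
    unfolding norm_divide[symmetric] using wne by (simp add: h_def add_divide_distrib)
  finally have step: "norm (w + of_real \<epsilon>) \<le>
    norm w * ((norm (w + 1) / norm w) powr \<epsilon> * exp (1 / (Re z + real n)^2 * B))" .
  have "norm (pochhammer (z + of_real \<epsilon>) (Suc n)) = norm (pochhammer (z + of_real \<epsilon>) n) * norm (w + of_real \<epsilon>)"
    by (simp add: pochhammer_Suc norm_mult w_def add_ac)
  also have "\<dots> \<le> (norm (pochhammer z n) * (norm w / norm z) powr \<epsilon> *
    exp ((\<Sum>k<n. 1 / (Re z + real k)^2) * B)) * (norm w * ((norm (w + 1) / norm w) powr \<epsilon> * exp (1 / (Re z + real n)^2 * B)))"
    using Suc.IH step unfolding w_def B_def by (intro mult_mono) auto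
  also have "\<dots> = (norm (pochhammer z n) * norm w) * ((norm w / norm z) powr \<epsilon> * (norm (w + 1) / norm w) powr \<epsilon>) *
    (exp ((\<Sum>k<n. 1 / (Re z + real k)^2) * B) * exp (1 / (Re z + real n)^2 * B))"
    by (simp only: mult_ac)
  also have "norm (pochhammer z n) * norm w = norm (pochhammer z (Suc n))"
    by (simp add: pochhammer_Suc norm_mult w_def)
  also have "(norm w / norm z) powr \<epsilon> * (norm (w + 1) / norm w) powr \<epsilon> = (norm (z + of_nat (Suc n)) / norm z) powr \<epsilon>"
    using w0 by (simp flip: powr_mult add: w_def add_ac)
  also have "exp ((\<Sum>k<n. 1 / (Re z + real k)^2) * B) * exp (1 / (Re z + real n)^2 * B) =
    exp ((\<Sum>k<Suc n. 1 / (Re z + real k)^2) * B)"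
    by (simp add: exp_add[symmetric] distrib_right)
  finally show ?case by (simp add: B_def)
qed

text \<open>Shifting the argument by \<open>\<epsilon>\<close> multiplies \<open>|\<Gamma>|\<close> by at least a constant times \<open>|z|\<^sup>\<epsilon>\<close>, uniformly
  on a vertical line. Insert the estimate for Pochhammer symbols in Gauss's product formula.\<close>

lemma Gamma_shift_lower_bound:
  fixes q \<epsilon> :: real
  assumes q: "0 < q" and \<epsilon>: "0 < \<epsilon>" "\<epsilon> < 1"
  obtains C where "0 < C"
    "\<And>z::complex. Re z = q \<Longrightarrow> norm z powr \<epsilon> * norm (Gamma z) \<le> C * norm (Gamma (z + of_real \<epsilon>))"
proof -
  have sm: "summable (\<lambda>k. 1 / (q + real k)^2)"
  proof (rule summable_comparison_test_ev)
    show "summable (\<lambda>k. inverse (real k ^ 2))" by (rule inverse_power_summable) simp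
    show "\<forall>\<^sub>F k in sequentially. norm (1 / (q + real k)\<^sup>2) \<le> inverse (real k ^ 2)"
      using eventually_gt_at_top[of 0]
    proof eventually_elim
      case (elim k)
      then have "real k ^ 2 \<le> (q + real k)^2" using q by (intro power_mono) auto
      then show ?case using elim q by (simp add: field_simps)
    qed
  qed
  define C where "C = exp ((\<Sum>k. 1 / (q + real k)^2) * (2 + 1/q)^2)"
  have "norm z powr \<epsilon> * norm (Gamma z) \<le> C * norm (Gamma (z + of_real \<epsilon>))" if z: "Re z = q" for z :: complex
  proof -
    have z0: "0 < norm z" using z q by auto
    have lim1: "(\<lambda>n. C * norm (Gamma_series (z + of_real \<epsilon>) n)) \<longlonglongrightarrow> C * norm (Gamma (z + of_real \<epsilon>))"
      by (intro tendsto_intros Gamma_series_LIMSEQ)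
    have "(\<lambda>n. (real n * norm z / (norm z + real n + 1)) powr \<epsilon>) \<longlonglongrightarrow> norm z powr \<epsilon>"
    proof -
      have "(\<lambda>n. real n * a / (a + real n + 1)) \<longlonglongrightarrow> a" if "0 < a" for a :: real
        using that by real_asymp
      from this[OF z0] show ?thesis using z0 by (intro tendsto_powr tendsto_const) auto
    qed
    from tendsto_mult[OF this tendsto_norm[OF Gamma_series_LIMSEQ]]
    have lim2: "(\<lambda>n. (real n * norm z / (norm z + real n + 1)) powr \<epsilon> * norm (Gamma_series z n))
      \<longlonglongrightarrow> norm z powr \<epsilon> * norm (Gamma z)" .
    have "\<forall>\<^sub>F n in sequentially. (real n * norm z / (norm z + real n + 1)) powr \<epsilon> * norm (Gamma_series z n)
      \<le> C * norm (Gamma_series (z + of_real \<epsilon>) n)"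
      using eventually_gt_at_top[of 0]
    proof eventually_elim
      case (elim n)
      define P where "P = norm (pochhammer z (n + 1))"
      define P' where "P' = norm (pochhammer (z + of_real \<epsilon>) (n + 1))"
      have pos: "0 < P" "0 < P'"
      proof -
        have "pochhammer v m \<noteq> 0" if "0 < Re v" for v :: complex and m
          using that unfolding pochhammer_eq_0_iff by force
        then show "0 < P" "0 < P'" using z q \<epsilon> by (simp_all add: P_def P'_def)
      qed
      define r where "r = norm z + n + 1"
      have r: "0 < r" using z0 unfolding r_def by linarith
      have "P' \<le> P * (norm (z + of_nat (n + 1)) / norm z) powr \<epsilon> *
          exp ((\<Sum>k<n+1. 1 / (q + real k)^2) * (2 + 1/q)^2)"
        using pochhammer_shift_le[of z \<epsilon> "n + 1"] z q \<epsilon> by (simp only: P_def P'_def)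
      also have "\<dots> \<le> P * (r / norm z) powr \<epsilon> * C"
      proof -
        have "norm (z + of_nat (n + 1)) \<le> r"
          using norm_triangle_ineq[of z "of_nat (n + 1)"] unfolding norm_of_nat by (simp add: r_def)
        moreover have "(\<Sum>k<n+1. 1 / (q + real k)^2) \<le> (\<Sum>k. 1 / (q + real k)^2)"
          using q by (intro sum_le_suminf sm) auto
        ultimately have
          "(norm (z + of_nat (n + 1)) / norm z) powr \<epsilon> \<le> (r / norm z) powr \<epsilon>"
          "exp ((\<Sum>k<n+1. 1 / (q + real k)^2) * (2 + 1/q)^2) \<le> C"
          using \<epsilon> z0 unfolding C_def exp_le_cancel_iff
          by (intro powr_mono2 divide_right_mono, simp_all only: norm_ge_zero less_imp_le zero_le_divide_iff simp_thms) (intro mult_right_mono, simp_all)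
        then show ?thesis using pos by (intro mult_mono mult_left_mono) simp_all
      qed
      finally have P': "P' \<le> P * (r / norm z) powr \<epsilon> * C" .
      have G: "norm (Gamma_series z n) = fact n * exp (q * ln n) / P"
        "norm (Gamma_series (z + of_real \<epsilon>) n) = fact n * exp (q * ln n) * n powr \<epsilon> / P'"
      proof -
        show "norm (Gamma_series z n) = fact n * exp (q * ln n) / P"
          unfolding Gamma_series_def norm_divide norm_mult P_def norm_exp_eq_Re norm_fact using z by simp
        have "exp ((q + \<epsilon>) * ln n) = exp (q * ln n) * n powr \<epsilon>"
          using elim by (simp add: powr_def distrib_right exp_add)
        then show "norm (Gamma_series (z + of_real \<epsilon>) n) = fact n * exp (q * ln n) * n powr \<epsilon> / P'"
          unfolding Gamma_series_def norm_divide norm_mult P'_def norm_exp_eq_Re norm_fact using z by simp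
      qed
      have "(n * norm z / r) powr \<epsilon> = n powr \<epsilon> / (r / norm z) powr \<epsilon>"
        using z0 r by (simp flip: powr_divide)
      then have "(n * norm z / r) powr \<epsilon> * norm (Gamma_series z n) = 
         (fact n * exp (q * ln n) * n powr \<epsilon>) * (1 / (P * (r / norm z) powr \<epsilon>))"
        unfolding G by (simp add: mult_ac)
      also have "\<dots> \<le> (fact n * exp (q * ln n) * n powr \<epsilon>) * (C / P')"
        using P' pos r z0 by (intro mult_left_mono) (auto simp: field_simps)
      also have "\<dots> = C * norm (Gamma_series (z + of_real \<epsilon>) n)" unfolding G by simp
      finally show ?case unfolding r_def .
    qed
    then show ?thesis by (rule tendsto_le[OF sequentially_bot lim1 lim2])
  qed
  then show thesis using that[of C] by (simp add: C_def)
qed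

text \<open>A full unit of the shift is taken care of by the functional equation, which gives the factor
  \<open>1/|z|\<close>.\<close>

lemma Gamma_ratio_bound:
  fixes q \<epsilon> :: real
  assumes q: "0 < q" and \<epsilon>: "0 < \<epsilon>" "\<epsilon> < 1"
  obtains C where "0 < C"
    "\<And>y. norm (Gamma (Complex q y)) / norm (Gamma (Complex (q + 1 + \<epsilon>) y)) \<le> C * norm (Complex q y) powr (- (1 + \<epsilon>))"
proof -
  obtain C where C: "0 < C"
    "\<And>z::complex. Re z = q \<Longrightarrow> norm z powr \<epsilon> * norm (Gamma z) \<le> C * norm (Gamma (z + of_real \<epsilon>))"
    using Gamma_shift_lower_bound[OF assms] by blast
  have "norm (Gamma (Complex q y)) / norm (Gamma (Complex (q + 1 + \<epsilon>) y)) \<le> C * norm (Complex q y) powr (- (1 + \<epsilon>))" for y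
  proof -
    define z where "z = Complex q y"
    have z: "Re z = q" by (simp add: z_def)
    have z0: "0 < norm z" using z q by auto
    have shift: "Complex (q + 1 + \<epsilon>) y = (z + of_real \<epsilon>) + 1" by (simp add: z_def complex_eq_iff)
    have ne: "z + of_real \<epsilon> \<notin> \<int>\<^sub>\<le>\<^sub>0"
      using z q \<epsilon> by (auto elim!: nonpos_Ints_cases simp: complex_eq_iff)
    have "norm z \<le> norm (z + of_real \<epsilon>)"
      unfolding cmod_def using z q \<epsilon> by (intro real_sqrt_le_mono add_mono) (auto intro: power_mono)
    then have "norm z * (norm z powr \<epsilon> * norm (Gamma z)) \<le> norm (z + of_real \<epsilon>) * (C * norm (Gamma (z + of_real \<epsilon>)))"
      by (rule mult_mono[OF _ C(2)[OF z]]) simp_all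
    also have "\<dots> = C * norm (Gamma (Complex (q + 1 + \<epsilon>) y))"
      unfolding shift using ne by (subst Gamma_plus1) (auto simp: norm_mult dest: plus_one_in_nonpos_Ints_imp)
    finally have le: "norm z powr (1 + \<epsilon>) * norm (Gamma z) \<le> C * norm (Gamma (Complex (q + 1 + \<epsilon>) y))"
      using z0 by (simp add: powr_add mult.assoc)
    have "Complex (q + 1 + \<epsilon>) y \<notin> \<int>\<^sub>\<le>\<^sub>0"
      using q \<epsilon> by (auto elim!: nonpos_Ints_cases simp: complex_eq_iff)
    then have "0 < norm (Gamma (Complex (q + 1 + \<epsilon>) y))" by (simp add: Gamma_eq_zero_iff)
    then show ?thesis using le z0
      unfolding z_def[symmetric] powr_minus by (simp add: field_simps)
  qed
  then show thesis using that C(1) by blast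
qed

lemma integrable_norm_Complex_powr:
  assumes q: "0 < q" and s: "1 < s"
  shows "integrable lborel (\<lambda>y. norm (Complex q y) powr (- s))"
proof -
  define g where "g y = indicator {1..} y * y powr (-s)" for y :: real
  have gmeas [measurable]: "g \<in> borel_measurable borel" unfolding g_def by measurable
  have g: "integrable lborel g"
  proof (rule integrableI_nonneg)
    have "(\<integral>\<^sup>+y. ennreal (g y) \<partial>lborel) = (\<integral>\<^sup>+y. ennreal (y powr (-s)) * indicator {1..} y \<partial>lborel)"
      by (intro nn_integral_cong) (auto simp: g_def indicator_def)
    also have "\<dots> = ennreal (0 - (1 powr (1 - s) / (1 - s)))"
    proof (rule nn_integral_FTC_atLeast[where F = "\<lambda>y. y powr (1 - s) / (1 - s)"])
      show "((\<lambda>y. y powr (1 - s) / (1 - s)) has_real_derivative y powr (-s)) (at y)" if "1 \<le> y" for y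
        using that s by (auto intro!: derivative_eq_intros)
      show "((\<lambda>y. y powr (1 - s) / (1 - s)) \<longlongrightarrow> 0) at_top"
        using s by real_asymp
    qed auto
    finally show "(\<integral>\<^sup>+y. ennreal (g y) \<partial>lborel) < \<infinity>" by simp
  qed (auto simp: g_def)
  have g': "integrable lborel (\<lambda>y. g (- y))"
    using lborel_integrable_real_affine[of g "-1" 0] g by simp
  have h: "integrable lborel (\<lambda>y. indicator {-1..1::real} y * q powr (-s))"
    by simp
  show ?thesis
  proof (rule Bochner_Integration.integrable_bound)
    show "integrable lborel (\<lambda>y. indicator {-1..1::real} y * q powr (-s) + (g y + g (- y)))"
      by (intro Bochner_Integration.integrable_add h g g')
    show "AE y in lborel. norm (norm (Complex q y) powr - s) \<le> norm (indicator {-1..1::real} y * q powr (-s) + (g y + g (- y)))"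
    proof (intro AE_I2)
      fix y :: real
      have q1: "norm (Complex q y) powr (-s) \<le> q powr (-s)"
        using q s complex_Re_le_cmod[of "Complex q y"] by (intro powr_mono2') auto
      have y1: "norm (Complex q y) powr (-s) \<le> \<bar>y\<bar> powr (-s)" if "y \<noteq> 0"
        using that s abs_Im_le_cmod[of "Complex q y"] by (intro powr_mono2') auto
      have nn: "0 \<le> indicator {-1..1::real} y * q powr (-s)" "0 \<le> g y" "0 \<le> g (- y)"
        by (auto simp: g_def)
      consider "\<bar>y\<bar> \<le> 1" | "y \<ge> 1" | "y \<le> -1" by linarith
      then have "norm (Complex q y) powr (-s) \<le> indicator {-1..1::real} y * q powr (-s) + (g y + g (- y))"
      proof cases
        case 1
        then have "indicator {-1..1::real} y = (1::real)" by (auto simp: indicator_def)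
        then show ?thesis using q1 nn by simp
      next
        case 2
        then have "g y = \<bar>y\<bar> powr (-s)" by (auto simp: g_def)
        then show ?thesis using y1 nn 2 by linarith
      next
        case 3
        then have "g (- y) = \<bar>y\<bar> powr (-s)" by (auto simp: g_def)
        then show ?thesis using y1 nn 3 by linarith
      qed
      then show "norm (norm (Complex q y) powr - s) \<le> norm (indicator {-1..1::real} y * q powr (-s) + (g y + g (- y)))"
        using nn by simp
    qed
  qed (simp add: Complex_eq)
qed

section \<open>Laws with integrable characteristic function\<close>

lemma integral_iexp_Ioc:
  fixes a b t :: real
  assumes "a \<le> b" "t \<noteq> 0"
  shows "(\<integral>x. indicator {a<..b} x *\<^sub>R iexp (- (t * x)) \<partial>lborel)
      = (iexp (- (t * a)) - iexp (- (t * b))) / (\<i> * t)"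
proof -
  let ?F = "\<lambda>x::real. - iexp (- (t * x)) / (\<i> * t)"
  have "((\<lambda>x. iexp (- (t * x))) has_integral ?F b - ?F a) {a..b}"
  proof (rule fundamental_theorem_of_calculus[OF assms(1)])
    fix x :: real
    have "((\<lambda>z. - exp (\<i> * (- (of_real t * z))) / (\<i> * of_real t)) has_field_derivative
       exp (\<i> * (- (of_real t * of_real x)))) (at (of_real x))"
      using assms(2) by (auto intro!: derivative_eq_intros simp: mult.commute[of _ \<i>])
    from has_vector_derivative_real_field[OF this]
    show "(?F has_vector_derivative iexp (- (t * x))) (at x within {a..b})" by simp
  qed
  moreover have "set_integrable lborel {a..b} (\<lambda>x. iexp (- (t * x)))"
    by (intro borel_integrable_atLeastAtMost' continuous_intros)
  ultimately have "(LINT x:{a..b}|lborel. iexp (- (t * x))) = ?F b - ?F a"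
    using set_borel_integral_eq_integral(2)[of "{a..b}" "\<lambda>x. iexp (- (t * x))"]
    by (simp add: integral_unique)
  moreover have "(LINT x:{a..b}|lborel. iexp (- (t * x))) = (\<integral>x. indicator {a<..b} x *\<^sub>R iexp (- (t * x)) \<partial>lborel)"
    unfolding set_lebesgue_integral_def
  proof (rule integral_cong_AE)
    have "AE x in lborel. x \<noteq> a" by (rule AE_lborel_singleton)
    then show "AE x in lborel. indicat_real {a..b} x *\<^sub>R iexp (- (t * x)) = indicat_real {a<..b} x *\<^sub>R iexp (- (t * x))"
      by eventually_elim (auto simp: indicator_def)
  qed auto
  ultimately show ?thesis by (simp add: diff_divide_distrib)
qed

context real_distribution
begin

text \<open>Levy's inversion formula, where integrability turns the principal value into a Lebesgue
  integral.\<close>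

lemma measure_Ioc_eq_char_integral:
  assumes int: "integrable lborel (char M)" and "a \<le> b" and "measure M {a} = 0" "measure M {b} = 0"
  shows "complex_of_real (measure M {a<..b}) =
     1 / (2 * pi) * (\<integral>t. (iexp (- (t * a)) - iexp (- (t * b))) / (\<i> * t) * char M t \<partial>lborel)"
proof -
  define K where "K t = (iexp (- (t * a)) - iexp (- (t * b))) / (\<i> * t)" for t :: real
  have K: "norm (K t) \<le> b - a" for t
    using Levy_Inversion_aux2[of "-b" "-a" t] \<open>a \<le> b\<close> unfolding K_def by (cases "t = 0") auto
  have [measurable]: "K \<in> borel_measurable borel" "char M \<in> borel_measurable borel"
    subgoal unfolding K_def by measurable
    subgoal using int by (auto simp: integrable_iff_bounded)
    done
  have "(\<lambda>T::nat. (CLBINT t=-real T..real T. K t * char M t)) \<longlonglongrightarrow> (\<integral>t. K t * char M t \<partial>lborel)"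
  proof -
    have eq: "(CLBINT t=-real T..real T. K t * char M t) =
        (\<integral>t. indicator {-real T<..<real T} t *\<^sub>R (K t * char M t) \<partial>lborel)" for T
      by (simp add: interval_lebesgue_integral_def set_lebesgue_integral_def)
    show ?thesis unfolding eq
    proof (rule integral_dominated_convergence)
      show "integrable lborel (\<lambda>t. (b - a) * norm (char M t))" using int by simp
      show "AE t in lborel. (\<lambda>T. indicat_real {-real T<..<real T} t *\<^sub>R (K t * char M t)) \<longlonglongrightarrow> K t * char M t"
      proof (intro AE_I2 tendsto_eventually)
        fix t :: real
        obtain N :: nat where N: "\<bar>t\<bar> < N" using reals_Archimedean2 by blast
        show "\<forall>\<^sub>F T in sequentially. indicat_real {-real T<..<real T} t *\<^sub>R (K t * char M t) = K t * char M t"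
          using eventually_ge_at_top[of N]
        proof eventually_elim
          case (elim T)
          then have "\<bar>t\<bar> < real T" using N by simp
          then have "t \<in> {-real T<..<real T}" by auto
          then show ?case by simp
        qed
      qed
      show "AE t in lborel. norm (indicat_real {-real T<..<real T} t *\<^sub>R (K t * char M t)) \<le> (b - a) * norm (char M t)" for T
        using K \<open>a \<le> b\<close> by (intro AE_I2) (auto simp: indicator_def norm_mult intro: mult_right_mono)
    qed measurable
  qed
  then have "(\<lambda>T::nat. 1 / (2 * pi) * (CLBINT t=-real T..real T. K t * char M t)) \<longlonglongrightarrow> 1 / (2 * pi) * (\<integral>t. K t * char M t \<partial>lborel)"
    by (intro tendsto_intros)
  with Levy_Inversion[OF assms(2-4), unfolded of_int_minus of_int_of_nat_eq, folded K_def]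
  show ?thesis unfolding K_def[symmetric] by (rule LIMSEQ_unique)
qed

text \<open>The inversion formula bounds the mass of an interval, whose end points are not atoms, by a
  multiple of its length. Such end points exist arbitrarily near to \<open>c\<close> because there are only
  countably many atoms.\<close>

lemma no_atoms_if_char_integrable:
  assumes int: "integrable lborel (char M)"
  shows "measure M {c} = 0"
proof -
  define A where "A = 1 / (2 * pi) * (\<integral>t. norm (char M t) \<partial>lborel)"
  have A: "0 \<le> A" by (simp add: A_def)
  have cnt: "countable {x. measure M {x} \<noteq> 0}" by (rule countable_support)
  have le: "measure M {c} \<le> e * (2 * A)" if e: "0 < e" for e
  proof -
    have ex: "\<exists>a. u < a \<and> a < v \<and> measure M {a} = 0" if "u < v" for u v
    proof (rule ccontr)
      assume "\<not> ?thesis"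
      then have "{u<..<v} \<subseteq> {x. measure M {x} \<noteq> 0}" by auto
      then have "countable {u<..<v}" using cnt countable_subset by blast
      then show False using uncountable_open_interval[of u v] that by simp
    qed
    obtain a where a: "c - e < a" "a < c" "measure M {a} = 0"
      using ex[of "c - e" c] e by auto
    obtain b where b: "c < b" "b < c + e" "measure M {b} = 0"
      using ex[of c "c + e"] e by auto
    define K where "K t = (iexp (- (t * a)) - iexp (- (t * b))) / (\<i> * t)" for t :: real
    have K: "norm (K t) \<le> b - a" for t
      using Levy_Inversion_aux2[of "-b" "-a" t] a b unfolding K_def by (cases "t = 0") auto
    have [measurable]: "K \<in> borel_measurable borel" "char M \<in> borel_measurable borel"
      subgoal unfolding K_def by measurable
    subgoal using int by (auto simp: integrable_iff_bounded)
    done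
    have "measure M {c} \<le> measure M {a<..b}"
      using a b by (intro finite_measure_mono) auto
    also have "\<dots> = norm (complex_of_real (measure M {a<..b}))" by simp
    also have "\<dots> = 1 / (2 * pi) * norm (\<integral>t. K t * char M t \<partial>lborel)"
      using a b unfolding K_def by (subst measure_Ioc_eq_char_integral[OF int]) (auto simp: norm_mult norm_divide)
    also have "\<dots> \<le> 1 / (2 * pi) * (\<integral>t. (b - a) * norm (char M t) \<partial>lborel)"
    proof -
      have i1: "integrable lborel (\<lambda>t. (b - a) * norm (char M t))" using int by simp
      have le1: "norm (K t * char M t) \<le> (b - a) * norm (char M t)" for t
        unfolding norm_mult using K by (rule mult_right_mono) simp
      have "norm (K t * char M t) \<le> norm ((b - a) * norm (char M t))" for t
        using le1[of t] by simp
      then have "integrable lborel (\<lambda>t. K t * char M t)"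
        by (intro Bochner_Integration.integrable_bound[OF i1]) auto
      then have "(\<integral>t. norm (K t * char M t) \<partial>lborel) \<le> (\<integral>t. (b - a) * norm (char M t) \<partial>lborel)"
        using i1 le1 by (intro integral_mono integrable_norm) auto
      then have "norm (\<integral>t. K t * char M t \<partial>lborel) \<le> (\<integral>t. (b - a) * norm (char M t) \<partial>lborel)"
        using integral_norm_bound by (rule order_trans[rotated])
      then show ?thesis by (intro mult_left_mono) auto
    qed
    also have "\<dots> = (b - a) * A" by (simp add: A_def)
    also have "\<dots> \<le> (2 * e) * A" using a b A by (intro mult_right_mono) auto
    finally show ?thesis by (simp add: mult_ac)
  qed
  have "measure M {c} \<le> 0"
  proof (rule field_le_epsilon)
    fix e :: real assume "0 < e"
    have "measure M {c} \<le> e / (2 * A + 1) * (2 * A)" using \<open>0 < e\<close> A by (intro le) auto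
    also have "\<dots> \<le> e" using \<open>0 < e\<close> A by (simp add: field_simps)
    finally show "measure M {c} \<le> 0 + e" by simp
  qed
  then show ?thesis using measure_nonneg[of M "{c}"] by linarith
qed

text \<open>By Fubini, the inversion formula says that the law has the continuous density \<open>f\<close>, the inverse
  Fourier transform of the characteristic function. As the total mass is not zero, \<open>f\<close> is positive
  somewhere, hence near some point.\<close>

theorem positive_on_interval_if_char_integrable:
  assumes int: "integrable lborel (char M)"
  obtains l r where "l < r" "\<And>a b. l \<le> a \<Longrightarrow> a < b \<Longrightarrow> b \<le> r \<Longrightarrow> 0 < measure M {a<..b}"
proof -
  define g where "g x = (\<integral>t. iexp (- (t * x)) * char M t \<partial>lborel)" for x
  define f where "f x = Re (g x) / (2 * pi)" for x
  have [measurable]: "char M \<in> borel_measurable borel"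
    using int by (auto simp: integrable_iff_bounded)
  have g_cont: "isCont g x" for x
    unfolding continuous_at_sequentially comp_def
  proof safe
    fix X assume X: "X \<longlonglongrightarrow> x"
    show "(\<lambda>n. g (X n)) \<longlonglongrightarrow> g x"
      unfolding g_def
    proof (rule integral_dominated_convergence)
      show "integrable lborel (\<lambda>t. norm (char M t))" using int by simp
      show "AE t in lborel. (\<lambda>n. iexp (- (t * X n)) * char M t) \<longlonglongrightarrow> iexp (- (t * x)) * char M t"
        using X by (intro AE_I2 tendsto_intros)
    qed (auto simp: norm_mult)
  qed
  have f_cont: "isCont f x" for x
    unfolding f_def using g_cont[of x] by (auto intro!: continuous_intros)
  have f_int: "set_integrable lborel {a..b} f" for a b
    by (intro borel_integrable_atLeastAtMost' continuous_at_imp_continuous_on ballI f_cont)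
  have [measurable]: "f \<in> borel_measurable borel"
    using f_cont by (intro borel_measurable_continuous_onI continuous_at_imp_continuous_on) auto
  have f_int': "integrable lborel (\<lambda>x. indicator {a<..b} x *\<^sub>R f x)" for a b
    unfolding set_integrable_def[symmetric] by (rule set_integrable_subset[OF f_int[of a b]]) auto
  have meas: "measure M {a<..b} = (\<integral>x. indicator {a<..b} x *\<^sub>R f x \<partial>lborel)" if "a \<le> b" for a b
  proof -
    let ?K = "\<lambda>t::real. (iexp (- (t * a)) - iexp (- (t * b))) / (\<i> * t)"
    let ?H = "\<lambda>t x. indicator {a<..b} x *\<^sub>R (iexp (- (t * x)) * char M t)"
    have A: "integrable lborel (?H t)" for t
      by (rule integrableI_bounded_set_indicator[where B = "norm (char M t)"]) (auto simp: norm_mult that)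
    have "(\<integral>x. norm (?H t x) \<partial>lborel) = (b - a) * norm (char M t)" for t
    proof -
      have "(\<integral>x. norm (?H t x) \<partial>lborel) = (\<integral>x. indicator {a<..b} x * norm (char M t) \<partial>lborel)"
        unfolding norm_scaleR norm_mult norm_exp_i_times by simp
      then show ?thesis using that by simp
    qed
    then have B: "integrable lborel (\<lambda>t. \<integral>x. norm (?H t x) \<partial>lborel)"
      using int by simp
    have "integrable (lborel \<Otimes>\<^sub>M lborel) (\<lambda>(t, x). ?H t x)"
    proof (rule lborel_pair.Fubini_integrable, goal_cases)
      case 1
      show ?case by measurable
    next
      case 2
      then show ?case using B by (simp only: prod.case)
    next
      case 3
      then show ?case using A by (simp only: prod.case) simp
    qed
    from lborel_pair.Fubini_integral[OF this]
    have "(\<integral>x. \<integral>t. ?H t x \<partial>lborel \<partial>lborel) = (\<integral>t. \<integral>x. ?H t x \<partial>lborel \<partial>lborel)" .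
    also have "\<dots> = (\<integral>t. ?K t * char M t \<partial>lborel)"
    proof (rule integral_cong_AE)
      have "AE t in lborel. t \<noteq> (0::real)" by (rule AE_lborel_singleton)
      then show "AE t in lborel. (\<integral>x. ?H t x \<partial>lborel) = ?K t * char M t"
      proof eventually_elim
        case (elim t)
        have "(\<integral>x. ?H t x \<partial>lborel) = (\<integral>x. (indicator {a<..b} x *\<^sub>R iexp (- (t * x))) * char M t \<partial>lborel)"
          by (intro Bochner_Integration.integral_cong) auto
        also have "\<dots> = (\<integral>x. indicator {a<..b} x *\<^sub>R iexp (- (t * x)) \<partial>lborel) * char M t"
          by (rule integral_mult_left_zero)
        also have "\<dots> = ?K t * char M t" using integral_iexp_Ioc[OF that elim] by simp
        finally show ?case .
      qed
    qed measurable
    also have "\<dots> = 2 * pi * complex_of_real (measure M {a<..b})"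
      by (subst measure_Ioc_eq_char_integral[OF int that no_atoms_if_char_integrable[OF int] no_atoms_if_char_integrable[OF int]]) simp
    also have "(\<integral>x. \<integral>t. ?H t x \<partial>lborel \<partial>lborel) = (\<integral>x. indicator {a<..b} x *\<^sub>R g x \<partial>lborel)"
      unfolding g_def by (intro Bochner_Integration.integral_cong) auto
    finally have "Re (\<integral>x. indicator {a<..b} x *\<^sub>R g x \<partial>lborel) = 2 * pi * measure M {a<..b}" by simp
    moreover have gi: "integrable lborel (\<lambda>x. indicator {a<..b} x *\<^sub>R g x)"
      unfolding set_integrable_def[symmetric]
      by (rule set_integrable_subset[OF borel_integrable_atLeastAtMost'[of a b g]])
        (auto intro!: continuous_at_imp_continuous_on g_cont)
    ultimately have "(\<integral>x. Re (indicator {a<..b} x *\<^sub>R g x) \<partial>lborel) = 2 * pi * measure M {a<..b}"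
      using integral_Re[OF gi] by metis
    moreover have "(\<integral>x. indicator {a<..b} x *\<^sub>R f x \<partial>lborel) = (\<integral>x. Re (indicator {a<..b} x *\<^sub>R g x) \<partial>lborel) / (2 * pi)"
      unfolding integral_divide_zero[symmetric] f_def by (intro Bochner_Integration.integral_cong) auto
    ultimately show ?thesis by simp
  qed
  have "\<exists>c. 0 < f c"
  proof (rule ccontr)
    assume "\<nexists>c. 0 < f c"
    then have nonpos: "f x \<le> 0" for x by (simp add: not_less)
    have z: "measure M {- real n<..real n} = 0" for n
    proof -
      have "(\<integral>x. indicator {- real n<..real n} x *\<^sub>R f x \<partial>lborel) \<le> integral\<^sup>L lborel (\<lambda>x::real. 0)"
        by (rule integral_mono[OF f_int']) (auto simp: indicator_def nonpos)
      then have "measure M {- real n<..real n} \<le> 0"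
        by (subst meas) auto
      then show ?thesis using measure_nonneg[of M] by (simp add: antisym)
    qed
    have "(\<lambda>n. measure M {- real n<..real n}) \<longlonglongrightarrow> measure M (\<Union>n. {- real n<..real n})"
      by (intro finite_Lim_measure_incseq) (auto simp: incseq_def)
    moreover have "(\<Union>n. {- real n<..real n}) = UNIV"
    proof safe
      fix x :: real
      obtain n :: nat where "\<bar>x\<bar> < n" using reals_Archimedean2 by blast
      then show "x \<in> (\<Union>n. {- real n<..real n})" by (intro UN_I[of n]) auto
    qed simp
    ultimately have "measure M UNIV = 0" using z by (simp add: LIMSEQ_const_iff)
    then show False using prob_space by simp
  qed
  then obtain c where c: "0 < f c" ..
  from f_cont[of c] have "\<forall>\<^sub>F x in at c. f c / 2 < f x"
    using c by (intro order_tendstoD(1)[of f "f c"]) (auto simp: isCont_def)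
  then obtain d where d: "0 < d" "\<And>x. x \<noteq> c \<Longrightarrow> dist x c < d \<Longrightarrow> f c / 2 < f x"
    by (auto simp: eventually_at)
  have fpos: "f c / 2 \<le> f x" if "\<bar>x - c\<bar> < d" for x
    using d(2)[of x] that c by (cases "x = c") (auto simp: dist_real_def)
  show thesis
  proof (rule that[of "c - d/2" "c + d/2"])
    show "0 < measure M {a<..b}" if "c - d/2 \<le> a" "a < b" "b \<le> c + d/2" for a b
    proof -
      have "0 < (b - a) * (f c / 2)" using that c by simp
      also have "\<dots> = (\<integral>x. indicator {a<..b} x *\<^sub>R (f c / 2) \<partial>lborel)" using that by simp
      also have "\<dots> \<le> (\<integral>x. indicator {a<..b} x *\<^sub>R f x \<partial>lborel)"
      proof (rule integral_mono[OF _ f_int'])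
        show "integrable lborel (\<lambda>x. indicator {a<..b} x *\<^sub>R (f c / 2))"
          by (intro integrable_scaleR_left integrable_real_indicator) (use that in auto)
        show "indicator {a<..b} x *\<^sub>R (f c / 2) \<le> indicator {a<..b} x *\<^sub>R f x" for x
          using fpos[of x] that d(1) by (cases "x \<in> {a<..b}") (auto simp: abs_less_iff)
      qed
      also have "\<dots> = measure M {a<..b}" using meas[of a b] that by simp
      finally show ?thesis .
    qed
  qed (use d in auto)
qed

end

section \<open>Gamma and Gaussian integrals\<close>

text \<open>Euler's integral on the multiplicative scale \<open>t = e\<^sup>s\<close>, on which scaling and inversion of \<open>t\<close>
  become translation and reflection of \<open>s\<close>. The next two lemmas express \<open>D\<^sup>-\<^sup>p\<close> and \<open>X\<^sup>-\<^sup>p\<close> (written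
  with \<open>exp\<close> and \<open>ln\<close>) in this way.\<close>

lemma has_bochner_integral_Gamma_exp:
  fixes p :: complex
  assumes p: "0 < Re p"
  shows "has_bochner_integral lborel (\<lambda>s. exp (p * of_real s - of_real (exp s))) (Gamma p)"
proof -
  define f where "f t = of_real t powr (p - 1) / of_real (exp t)" for t :: real
  have "f absolutely_integrable_on {0<..} \<and> integral {0<..} f = Gamma p"
    using absolutely_integrable_Gamma_integral'[OF p] Gamma_integral_complex'[OF p]
    unfolding f_def by (simp add: integral_unique)
  moreover have "{0<..} = range (exp :: real \<Rightarrow> real)" by (auto intro: exp_ln[symmetric] rangeI)
  ultimately have "(\<lambda>s. \<bar>exp s\<bar> *\<^sub>R f (exp s)) absolutely_integrable_on UNIV \<and>
    integral UNIV (\<lambda>s. \<bar>exp s\<bar> *\<^sub>R f (exp s)) = Gamma p"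
    by (subst has_absolute_integral_change_of_variables_real[where f = f and g = exp]) (auto intro!: derivative_eq_intros simp: inj_on_def)
  also have "(\<lambda>s. \<bar>exp s\<bar> *\<^sub>R f (exp s)) = (\<lambda>s. exp (p * of_real s - of_real (exp s)))"
  proof
    fix s :: real
    have "exp (p * of_real s - of_real (exp s)) = exp (of_real s) * (exp ((p - 1) * of_real s) / exp (of_real (exp s)))"
      by (simp add: exp_diff[symmetric] exp_add[symmetric] algebra_simps)
    then show "\<bar>exp s\<bar> *\<^sub>R f (exp s) = exp (p * of_real s - of_real (exp s))"
      by (simp add: f_def powr_def Ln_of_real exp_of_real scaleR_conv_of_real)
  qed
  finally have *: "(\<lambda>s. exp (p * of_real s - of_real (exp s))) absolutely_integrable_on UNIV"
    "integral UNIV (\<lambda>s. exp (p * of_real s - of_real (exp s))) = Gamma p" by auto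
  have int: "integrable lborel (\<lambda>s. exp (p * of_real s - of_real (exp s)))"
    using *(1) by (simp add: set_integrable_def integrable_completion)
  then have "(LINT s|lborel. exp (p * of_real s - of_real (exp s))) = Gamma p"
    using integral_lborel[OF int] *(2) by simp
  with int show ?thesis by (simp add: has_bochner_integral_iff)
qed

lemma has_bochner_integral_Gamma_exp_scaled:
  fixes p :: complex and D :: real
  assumes p: "0 < Re p" and D: "0 < D"
  shows "has_bochner_integral lborel (\<lambda>s. exp (p * of_real s - of_real (exp s * D))) (Gamma p * exp (- p * of_real (ln D)))"
proof -
  have "has_bochner_integral lborel (\<lambda>s. exp (p * of_real (ln D + 1 * s) - of_real (exp (ln D + 1 * s)))) (Gamma p /\<^sub>R \<bar>1\<bar>)"
    using has_bochner_integral_Gamma_exp[OF p]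
    by (subst (asm) lborel_has_bochner_integral_real_affine_iff[where c = 1 and t = "ln D"]) auto
  then have "has_bochner_integral lborel
     (\<lambda>s. exp (- p * of_real (ln D)) * exp (p * of_real (ln D + 1 * s) - of_real (exp (ln D + 1 * s))))
     (exp (- p * of_real (ln D)) * (Gamma p /\<^sub>R \<bar>1\<bar>))"
    by (rule has_bochner_integral_mult_right)
  moreover have "exp (- p * of_real (ln D)) * exp (p * of_real (ln D + 1 * s) - of_real (exp (ln D + 1 * s)))
     = exp (p * of_real s - of_real (exp s * D))" for s
    unfolding exp_add[symmetric] using D by (simp add: exp_add algebra_simps)
  ultimately show ?thesis by (simp add: mult.commute)
qed

lemma has_bochner_integral_Gamma_exp_reflected:
  fixes p :: complex and X :: real
  assumes p: "0 < Re p" and X: "0 < X"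
  shows "has_bochner_integral lborel (\<lambda>s. exp (- p * of_real s - of_real (exp (- s) * X))) (Gamma p * exp (- p * of_real (ln X)))"
proof -
  have "has_bochner_integral lborel (\<lambda>s. exp (p * of_real (0 + (-1) * s) - of_real (exp (0 + (-1) * s) * X))) ((Gamma p * exp (- p * of_real (ln X))) /\<^sub>R \<bar>-1\<bar>)"
    using has_bochner_integral_Gamma_exp_scaled[OF p X]
    by (subst (asm) lborel_has_bochner_integral_real_affine_iff[where c = "-1" and t = 0]) auto
  then show ?thesis by simp
qed

text \<open>The Fourier transform of a Gaussian on the line and, by taking products, on a coordinate space
  \<open>I \<rightarrow> \<real>\<close>. Coordinate spaces are used because the dimension needed later is one less than that of
  the ambient space.\<close>

lemma has_bochner_integral_gaussian_iexp:
  fixes c z :: real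
  assumes c: "0 < c"
  shows "has_bochner_integral lborel (\<lambda>x. complex_of_real (exp (- c * x\<^sup>2)) * iexp (x * z))
    (complex_of_real (sqrt (pi / c) * exp (- z\<^sup>2 / (4 * c))))"
proof -
  define k where "k = sqrt (2 * c)"
  have k: "0 < k" "k\<^sup>2 = 2 * c" using c by (simp_all add: k_def)
  define t where "t = z / k"
  define f where "f x = std_normal_density x *\<^sub>R iexp (t * x)" for x
  have [measurable]: "f \<in> borel_measurable borel" unfolding f_def by measurable
  have "integrable lborel f"
    by (rule Bochner_Integration.integrable_bound[of lborel std_normal_density])
      (auto simp: f_def normal_density_nonneg intro!: AE_I2)
  moreover have "integral\<^sup>L lborel f = exp (- (t^2) / 2)"
    using fun_cong[OF char_std_normal_distribution, of t]
    by (simp add: char_def f_def[abs_def] integral_density normal_density_nonneg)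
  ultimately have "has_bochner_integral lborel f (complex_of_real (exp (- (t^2) / 2)))"
    by (simp add: has_bochner_integral_iff)
  then have "has_bochner_integral lborel (\<lambda>x. f (0 + k * x)) (complex_of_real (exp (- (t^2) / 2)) /\<^sub>R \<bar>k\<bar>)"
    using k by (subst (asm) lborel_has_bochner_integral_real_affine_iff[where c = k and t = 0]) auto
  then have "has_bochner_integral lborel (\<lambda>x. complex_of_real (sqrt (2 * pi)) * f (0 + k * x))
    (complex_of_real (sqrt (2 * pi)) * (complex_of_real (exp (- (t^2) / 2)) /\<^sub>R \<bar>k\<bar>))"
    by (rule has_bochner_integral_mult_right)
  moreover have "complex_of_real (sqrt (2 * pi)) * f (0 + k * x) = complex_of_real (exp (- c * x\<^sup>2)) * iexp (x * z)" for x
  proof -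
    have e1: "(k * x)\<^sup>2 / 2 = c * x\<^sup>2" using k by (simp add: power_mult_distrib)
    have e2: "t * (k * x) = x * z" using k by (simp add: t_def)
    have e3: "sqrt (2 * pi) * std_normal_density (k * x) = exp (- c * x\<^sup>2)"
      using e1 by (simp add: std_normal_density_def)
    have "complex_of_real (sqrt (2 * pi)) * f (0 + k * x) =
        complex_of_real (sqrt (2 * pi) * std_normal_density (k * x)) * iexp (t * (k * x))"
      by (simp add: f_def scaleR_conv_of_real)
    then show ?thesis by (simp only: e2 e3)
  qed
  moreover have "complex_of_real (sqrt (2 * pi)) * (complex_of_real (exp (- (t^2) / 2)) /\<^sub>R \<bar>k\<bar>) =
     complex_of_real (sqrt (pi / c) * exp (- z\<^sup>2 / (4 * c)))"
  proof -
    have "t\<^sup>2 / 2 = z\<^sup>2 / (4 * c)" using k by (simp add: t_def power_divide)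
    moreover have "sqrt (2 * pi) / k = sqrt (pi / c)"
      using c by (simp add: k_def real_sqrt_divide[symmetric])
    ultimately show ?thesis
      using k by (simp add: scaleR_conv_of_real field_simps flip: of_real_mult of_real_divide)
  qed
  ultimately show ?thesis by simp
qed

lemma gaussian_iexp_PiM:
  fixes z :: "'i \<Rightarrow> real" and c :: real
  assumes I: "finite I" and c: "0 < c"
  shows "has_bochner_integral (Pi\<^sub>M I (\<lambda>_. lborel))
      (\<lambda>\<xi>. complex_of_real (exp (- c * (\<Sum>i\<in>I. (\<xi> i)\<^sup>2))) * iexp (\<Sum>i\<in>I. \<xi> i * z i))
      (complex_of_real (sqrt (pi / c) ^ card I * exp (- (\<Sum>i\<in>I. (z i)\<^sup>2) / (4 * c))))"
proof -
  interpret product_sigma_finite "\<lambda>_::'i. lborel :: real measure" ..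
  let ?f = "\<lambda>i x. complex_of_real (exp (- c * x\<^sup>2)) * iexp (x * z i)"
  note 1 = has_bochner_integral_gaussian_iexp[OF c]
  have "integrable (Pi\<^sub>M I (\<lambda>_. lborel)) (\<lambda>\<xi>. \<Prod>i\<in>I. ?f i (\<xi> i))"
    using 1 by (intro product_integrable_prod I) (auto simp: has_bochner_integral_iff)
  moreover have "(\<integral>\<xi>. (\<Prod>i\<in>I. ?f i (\<xi> i)) \<partial>Pi\<^sub>M I (\<lambda>_. lborel)) =
    (\<Prod>i\<in>I. complex_of_real (sqrt (pi / c) * exp (- (z i)\<^sup>2 / (4 * c))))"
    using 1 by (subst product_integral_prod[OF I]) (auto simp: has_bochner_integral_iff intro!: prod.cong)
  moreover have "(\<Prod>i\<in>I. ?f i (\<xi> i)) =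
     complex_of_real (exp (- c * (\<Sum>i\<in>I. (\<xi> i)\<^sup>2))) * iexp (\<Sum>i\<in>I. \<xi> i * z i)" for \<xi>
    using I by (simp add: prod.distrib exp_sum sum_distrib_left sum_negf[symmetric] del: of_real_exp)
  moreover have "(\<Prod>i\<in>I. complex_of_real (sqrt (pi / c) * exp (- (z i)\<^sup>2 / (4 * c)))) =
     complex_of_real (sqrt (pi / c) ^ card I * exp (- (\<Sum>i\<in>I. (z i)\<^sup>2) / (4 * c)))"
    using I by (simp add: prod.distrib exp_sum sum_divide_distrib sum_negf[symmetric] flip: of_real_prod)
  ultimately show ?thesis by (simp add: has_bochner_integral_iff)
qed

section \<open>Riesz energies of complex order\<close>

lemma has_bochner_integral_Gamma_exp_scaled_real:
  fixes a D :: real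
  assumes "0 < a" "0 < D"
  shows "has_bochner_integral lborel (\<lambda>s. exp (a * s - exp s * D)) (Gamma a * exp (- a * ln D))"
proof -
  have "has_bochner_integral lborel (\<lambda>s. Re (exp (of_real a * of_real s - of_real (exp s * D))))
     (Re (Gamma (of_real a) * exp (- of_real a * of_real (ln D))))"
    using assms by (intro has_bochner_integral_bounded_linear[OF bounded_linear_Re] has_bochner_integral_Gamma_exp_scaled) auto
  moreover have "exp (of_real a * of_real s - of_real (exp s * D)) = complex_of_real (exp (a * s - exp s * D))" for s
    by (simp add: exp_of_real[symmetric])
  moreover have "Gamma (of_real a) * exp (- of_real a * of_real (ln D)) = complex_of_real (Gamma a * exp (- a * ln D))"
    by (simp add: Gamma_complex_of_real exp_of_real[symmetric])
  ultimately show ?thesis by (simp only: Re_complex_of_real)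
qed

text \<open>A finite measure together with a map \<open>u\<close> to the coordinate space with index set \<open>I\<close>. Pairs of
  points are compared through the distance of their images.\<close>

locale measured_points = finite_measure M for M :: "'b measure" +
  fixes I :: "'i set" and u :: "'b \<Rightarrow> 'i \<Rightarrow> real"
  assumes finite_I: "finite I" and I_ne: "I \<noteq> {}"
    and u_meas [measurable]: "\<And>i. i \<in> I \<Longrightarrow> (\<lambda>x. u x i) \<in> borel_measurable M"
begin

definition sqdist :: "'b \<times> 'b \<Rightarrow> real" where
  "sqdist z = (\<Sum>i\<in>I. (u (fst z) i - u (snd z) i)\<^sup>2)"

text \<open>Lebesgue measure on the space of frequencies dual to the coordinate space.\<close>

definition freq :: "('i \<Rightarrow> real) measure" where
  "freq = Pi\<^sub>M I (\<lambda>_. lborel)"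

definition phase :: "'b \<Rightarrow> ('i \<Rightarrow> real) \<Rightarrow> real" where
  "phase x \<xi> = (\<Sum>i\<in>I. \<xi> i * u x i)"

text \<open>The Gaussian normalised such that its Fourier transform is \<open>exp (- e\<^sup>s |v|\<^sup>2)\<close>, as \<open>heat_iexp\<close>
  shows.\<close>

definition heat :: "real \<Rightarrow> ('i \<Rightarrow> real) \<Rightarrow> real" where
  "heat s \<xi> = exp (- (card I / 2) * s) / sqrt (4 * pi) ^ card I * exp (- (exp (- s) / 4) * (\<Sum>i\<in>I. (\<xi> i)\<^sup>2))"

text \<open>The integrals to be estimated are bilinear in \<open>h\<close>, with no complex conjugate, so the Fourier
  transforms at \<open>\<xi>\<close> and at \<open>-\<xi>\<close> both occur. If the second function is the conjugate of the first,
  then their product is a square \<open>|fourier f \<xi>|\<^sup>2\<close>.\<close>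

definition fourier :: "('b \<Rightarrow> complex) \<Rightarrow> ('i \<Rightarrow> real) \<Rightarrow> complex" where
  "fourier f \<xi> = (\<integral>x. f x * iexp (phase x \<xi>) \<partial>M)"

definition cofourier :: "('b \<Rightarrow> complex) \<Rightarrow> ('i \<Rightarrow> real) \<Rightarrow> complex" where
  "cofourier f \<xi> = (\<integral>x. f x * iexp (- phase x \<xi>) \<partial>M)"

sublocale pair: pair_sigma_finite M M ..

sublocale MM: finite_measure "M \<Otimes>\<^sub>M M"
  by (rule finite_measure_pair_measure) unfold_locales

sublocale coords: product_sigma_finite "\<lambda>_::'i. lborel :: real measure" ..

sublocale freq: sigma_finite_measure freq
  unfolding freq_def by (rule coords.sigma_finite[OF finite_I])

sublocale MM_freq: pair_sigma_finite "M \<Otimes>\<^sub>M M" freq ..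
sublocale MM_lborel: pair_sigma_finite "M \<Otimes>\<^sub>M M" "lborel :: real measure" ..
sublocale lborel_freq: pair_sigma_finite "lborel :: real measure" freq ..

lemma freq_coord [measurable]: "i \<in> I \<Longrightarrow> (\<lambda>\<xi>. \<xi> i) \<in> borel_measurable freq"
  unfolding freq_def using measurable_component_singleton[of i I "\<lambda>_. lborel"] by simp

lemma sqdist_meas [measurable]: "sqdist \<in> borel_measurable (M \<Otimes>\<^sub>M M)"
  unfolding sqdist_def by measurable

lemma sqdist_nonneg: "0 \<le> sqdist z"
  unfolding sqdist_def by (intro sum_nonneg) auto

lemma phase_meas [measurable (raw)]:
  assumes [measurable]: "f \<in> N \<rightarrow>\<^sub>M M" "g \<in> N \<rightarrow>\<^sub>M freq"
  shows "(\<lambda>w. phase (f w) (g w)) \<in> borel_measurable N"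
  unfolding phase_def by measurable

lemma heat_meas [measurable (raw)]:
  assumes [measurable]: "f \<in> borel_measurable N" "g \<in> N \<rightarrow>\<^sub>M freq"
  shows "(\<lambda>w. heat (f w) (g w)) \<in> borel_measurable N"
  unfolding heat_def by measurable

lemma heat_nonneg: "0 \<le> heat s \<xi>" by (simp add: heat_def)

lemma heat_iexp:
  "has_bochner_integral freq (\<lambda>\<xi>. of_real (heat s \<xi>) * iexp (phase x \<xi> - phase y \<xi>))
     (complex_of_real (exp (- exp s * sqdist (x, y))))"
proof -
  define c where "c = exp (- s) / 4"
  have c: "0 < c" by (simp add: c_def)
  define k where "k = exp (- (card I / 2) * s) / sqrt (4 * pi) ^ card I"
  have sq: "sqrt (pi / c) ^ card I = sqrt (4 * pi) ^ card I * exp (card I / 2 * s)"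
  proof -
    have "pi / c = 4 * pi * (exp (s/2))\<^sup>2"
      by (simp add: c_def exp_minus field_simps exp_double[symmetric])
    then have "sqrt (pi / c) = sqrt (4 * pi) * exp (s/2)" by (simp add: real_sqrt_mult)
    then show ?thesis by (simp add: power_mult_distrib exp_of_nat_mult[symmetric])
  qed
  have 1: "k * (sqrt (pi / c) ^ card I) = 1"
    unfolding sq k_def by (simp add: exp_minus field_simps)
  have "has_bochner_integral freq (\<lambda>\<xi>. complex_of_real k * (complex_of_real (exp (- c * (\<Sum>i\<in>I. (\<xi> i)\<^sup>2))) * iexp (\<Sum>i\<in>I. \<xi> i * (u x i - u y i))))
      (complex_of_real k * complex_of_real (sqrt (pi / c) ^ card I * exp (- (\<Sum>i\<in>I. (u x i - u y i)\<^sup>2) / (4 * c))))"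
    unfolding freq_def by (intro has_bochner_integral_mult_right gaussian_iexp_PiM finite_I c)
  moreover have "complex_of_real k * complex_of_real (sqrt (pi / c) ^ card I * exp (- (\<Sum>i\<in>I. (u x i - u y i)\<^sup>2) / (4 * c))) =
     complex_of_real (exp (- exp s * sqdist (x, y)))"
  proof -
    have "- (\<Sum>i\<in>I. (u x i - u y i)\<^sup>2) / (4 * c) = - exp s * sqdist (x, y)"
      by (simp add: sqdist_def c_def exp_minus field_simps)
    then show ?thesis
      unfolding of_real_mult[symmetric] mult.assoc[symmetric] 1 by simp
  qed
  moreover have "complex_of_real k * (complex_of_real (exp (- c * (\<Sum>i\<in>I. (\<xi> i)\<^sup>2))) * iexp (\<Sum>i\<in>I. \<xi> i * (u x i - u y i)))
     = of_real (heat s \<xi>) * iexp (phase x \<xi> - phase y \<xi>)" for \<xi>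
  proof -
    have "(\<Sum>i\<in>I. \<xi> i * (u x i - u y i)) = phase x \<xi> - phase y \<xi>"
      by (simp add: phase_def right_diff_distrib sum_subtractf)
    then show ?thesis by (simp only: heat_def k_def c_def of_real_mult mult.assoc)
  qed
  ultimately show ?thesis by simp
qed

lemma heat_integral: "has_bochner_integral freq (heat s) 1"
proof -
  obtain x0 :: 'b where True by simp
  have "has_bochner_integral freq (\<lambda>\<xi>. Re (of_real (heat s \<xi>) * iexp (phase x0 \<xi> - phase x0 \<xi>)))
     (Re (complex_of_real (exp (- exp s * sqdist (x0, x0)))))"
    by (intro has_bochner_integral_bounded_linear[OF bounded_linear_Re] heat_iexp)
  then show ?thesis by (simp add: sqdist_def)
qed

lemma integral_pair_product:
  fixes f g :: "'b \<Rightarrow> complex"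
  assumes [measurable]: "f \<in> borel_measurable M" "g \<in> borel_measurable M"
    and bd: "\<And>x. norm (f x) \<le> 1" "\<And>x. norm (g x) \<le> 1"
  shows "(\<integral>z. f (fst z) * g (snd z) \<partial>(M \<Otimes>\<^sub>M M)) = (\<integral>x. f x \<partial>M) * (\<integral>x. g x \<partial>M)"
proof -
  have "integrable (M \<Otimes>\<^sub>M M) (\<lambda>(x, y). f x * g y)"
    using bd by (intro MM.integrable_const_bound[where B = 1]) (auto simp: norm_mult case_prod_beta' intro!: AE_I2 mult_le_one)
  from pair.integral_fst[OF this] show ?thesis
    by (simp add: case_prod_beta')
qed

text \<open>For a fixed time \<open>s\<close> the Gaussian form is diagonal in frequency space. Everything is
  absolutely integrable here, so this is Fubini's theorem.\<close>

lemma heat_kernel_fourier: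
  fixes f g :: "'b \<Rightarrow> complex"
  assumes [measurable]: "f \<in> borel_measurable M" "g \<in> borel_measurable M"
    and bd: "\<And>x. norm (f x) \<le> 1" "\<And>x. norm (g x) \<le> 1"
  shows "has_bochner_integral freq (\<lambda>\<xi>. of_real (heat s \<xi>) * (fourier f \<xi> * cofourier g \<xi>))
     (\<integral>z. f (fst z) * g (snd z) * of_real (exp (- exp s * sqdist z)) \<partial>(M \<Otimes>\<^sub>M M))"
proof -
  define H where "H = (\<lambda>z \<xi>. f (fst z) * g (snd z) * (of_real (heat s \<xi>) * iexp (phase (fst z) \<xi> - phase (snd z) \<xi>)))"
  have [measurable]: "(\<lambda>(z, \<xi>). H z \<xi>) \<in> borel_measurable ((M \<Otimes>\<^sub>M M) \<Otimes>\<^sub>M freq)"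
    unfolding H_def by measurable
  have fg: "norm (f x * g y) \<le> 1" for x y
    using bd by (auto simp: norm_mult intro!: mult_le_one)
  have nH: "norm (H z \<xi>) \<le> heat s \<xi>" for z \<xi>
  proof -
    have "norm (H z \<xi>) = norm (f (fst z) * g (snd z)) * heat s \<xi>"
      unfolding H_def norm_mult norm_of_real norm_exp_i_times using heat_nonneg by simp
    also have "\<dots> \<le> 1 * heat s \<xi>" by (intro mult_right_mono fg heat_nonneg)
    finally show ?thesis by simp
  qed
  have hi: "integrable freq (heat s)" "integral\<^sup>L freq (heat s) = 1"
    using heat_integral[of s] by (auto simp: has_bochner_integral_iff)
  have Hz: "has_bochner_integral freq (H z) (f (fst z) * g (snd z) * of_real (exp (- exp s * sqdist z)))" for z
    unfolding H_def using heat_iexp[of s "fst z" "snd z"] by (intro has_bochner_integral_mult_right) simp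
  have HI: "integrable ((M \<Otimes>\<^sub>M M) \<Otimes>\<^sub>M freq) (\<lambda>(z, \<xi>). H z \<xi>)"
  proof (rule MM_freq.Fubini_integrable, goal_cases)
    case 1
    show ?case by measurable
  next
    case 2
    have "(\<integral>\<xi>. norm (H z \<xi>) \<partial>freq) \<le> 1" for z
      using Hz[of z] nH hi integral_mono[of freq "\<lambda>\<xi>. norm (H z \<xi>)" "heat s"]
      by (simp add: has_bochner_integral_iff)
    then show ?case
      by (intro MM.integrable_const_bound[where B = 1]) auto
  next
    case 3
    show ?case using Hz by (simp add: has_bochner_integral_iff)
  qed
  have in_z: "(\<integral>z. H z \<xi> \<partial>(M \<Otimes>\<^sub>M M)) = of_real (heat s \<xi>) * (fourier f \<xi> * cofourier g \<xi>)" if "\<xi> \<in> space freq" for \<xi>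
  proof -
    have [measurable]: "(\<lambda>x. phase x \<xi>) \<in> borel_measurable M" using that by measurable
    have "(\<integral>z. H z \<xi> \<partial>(M \<Otimes>\<^sub>M M)) = (\<integral>z. of_real (heat s \<xi>) * ((f (fst z) * iexp (phase (fst z) \<xi>)) * (g (snd z) * iexp (- phase (snd z) \<xi>))) \<partial>(M \<Otimes>\<^sub>M M))"
      unfolding H_def
      by (intro Bochner_Integration.integral_cong refl) (simp add: exp_diff exp_minus right_diff_distrib field_simps)
    also have "\<dots> = of_real (heat s \<xi>) * (\<integral>z. (f (fst z) * iexp (phase (fst z) \<xi>)) * (g (snd z) * iexp (- phase (snd z) \<xi>)) \<partial>(M \<Otimes>\<^sub>M M))"
      by (rule integral_mult_right_zero)
    also have "(\<integral>z. (f (fst z) * iexp (phase (fst z) \<xi>)) * (g (snd z) * iexp (- phase (snd z) \<xi>)) \<partial>(M \<Otimes>\<^sub>M M)) = fourier f \<xi> * cofourier g \<xi>"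
      unfolding fourier_def cofourier_def
      by (rule integral_pair_product) (measurable, unfold norm_mult norm_exp_i_times, use bd in simp_all)
    finally show ?thesis .
  qed
  have "(\<integral>\<xi>. \<integral>z. H z \<xi> \<partial>(M \<Otimes>\<^sub>M M) \<partial>freq) = (\<integral>z. \<integral>\<xi>. H z \<xi> \<partial>freq \<partial>(M \<Otimes>\<^sub>M M))"
    by (rule MM_freq.Fubini_integral[OF HI])
  also have "\<dots> = (\<integral>z. f (fst z) * g (snd z) * of_real (exp (- exp s * sqdist z)) \<partial>(M \<Otimes>\<^sub>M M))"
    using Hz by (intro Bochner_Integration.integral_cong refl) (simp add: has_bochner_integral_iff)
  finally have "(\<integral>\<xi>. \<integral>z. H z \<xi> \<partial>(M \<Otimes>\<^sub>M M) \<partial>freq) = \<dots>" .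
  moreover have "integrable freq (\<lambda>\<xi>. \<integral>z. H z \<xi> \<partial>(M \<Otimes>\<^sub>M M))"
    by (rule MM_freq.integrable_snd[OF HI])
  ultimately have "has_bochner_integral freq (\<lambda>\<xi>. \<integral>z. H z \<xi> \<partial>(M \<Otimes>\<^sub>M M))
     (\<integral>z. f (fst z) * g (snd z) * of_real (exp (- exp s * sqdist z)) \<partial>(M \<Otimes>\<^sub>M M))"
    by (simp add: has_bochner_integral_iff)
  then show ?thesis
    by (subst has_bochner_integral_cong[OF refl _ refl]) (auto simp: in_z[symmetric])
qed

lemma cofourier_cnj: "cofourier (\<lambda>x. cnj (f x)) \<xi> = cnj (fourier f \<xi>)"
proof -
  have "cnj (fourier f \<xi>) = (\<integral>x. cnj (f x * iexp (phase x \<xi>)) \<partial>M)"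
    unfolding fourier_def by (rule Bochner_Integration.integral_cnj[symmetric])
  then show ?thesis by (simp add: cofourier_def exp_cnj del: Bochner_Integration.integral_cnj)
qed

lemma fourier_cnj: "fourier (\<lambda>x. cnj (f x)) \<xi> = cnj (cofourier f \<xi>)"
proof -
  have "cnj (cofourier f \<xi>) = (\<integral>x. cnj (f x * iexp (- phase x \<xi>)) \<partial>M)"
    unfolding cofourier_def by (rule Bochner_Integration.integral_cnj[symmetric])
  then show ?thesis by (simp add: fourier_def exp_cnj del: Bochner_Integration.integral_cnj)
qed

text \<open>The Gaussian form with all phases removed. It bounds the Gaussian forms of functions of
  modulus at most one.\<close>

definition heat_energy :: "real \<Rightarrow> real" where
  "heat_energy s = (\<integral>z. exp (- exp s * sqdist z) \<partial>(M \<Otimes>\<^sub>M M))"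

text \<open>By the inequality of the means it suffices to integrate \<open>|fourier h|\<^sup>2\<close> and \<open>|cofourier h|\<^sup>2\<close>.
  These are the Gaussian forms of the pairs \<open>h, cnj h\<close> and \<open>cnj h, h\<close>.\<close>

lemma heat_fourier_le:
  assumes [measurable]: "h \<in> borel_measurable M" and bd: "\<And>x. norm (h x) \<le> 1"
  shows "integrable freq (\<lambda>\<xi>. heat s \<xi> * (norm (fourier h \<xi>) * norm (cofourier h \<xi>)))"
    and "(\<integral>\<xi>. heat s \<xi> * (norm (fourier h \<xi>) * norm (cofourier h \<xi>)) \<partial>freq) \<le> heat_energy s"
proof -
  have le1: "norm (f (fst z) * g (snd z) * complex_of_real (exp (- exp s * sqdist z))) \<le> exp (- exp s * sqdist z)"
    if "\<And>x. norm (f x) \<le> 1" "\<And>x. norm (g x) \<le> 1" for f g :: "'b \<Rightarrow> complex" and z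
  proof -
    have "norm (f (fst z) * g (snd z)) * exp (- exp s * sqdist z) \<le> 1 * exp (- exp s * sqdist z)"
      using that by (intro mult_right_mono) (auto simp: norm_mult intro!: mult_le_one)
    then show ?thesis by (simp add: norm_mult)
  qed
  have Ei: "integrable (M \<Otimes>\<^sub>M M) (\<lambda>z. exp (- exp s * sqdist z))"
    using sqdist_nonneg by (intro MM.integrable_const_bound[where B = 1]) auto
  have bound: "Re (\<integral>z. f (fst z) * g (snd z) * of_real (exp (- exp s * sqdist z)) \<partial>(M \<Otimes>\<^sub>M M)) \<le> heat_energy s"
    if [measurable]: "f \<in> borel_measurable M" "g \<in> borel_measurable M"
      and "\<And>x. norm (f x) \<le> 1" "\<And>x. norm (g x) \<le> 1" for f g :: "'b \<Rightarrow> complex"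
  proof -
    have "Re (\<integral>z. f (fst z) * g (snd z) * of_real (exp (- exp s * sqdist z)) \<partial>(M \<Otimes>\<^sub>M M))
       \<le> norm (\<integral>z. f (fst z) * g (snd z) * of_real (exp (- exp s * sqdist z)) \<partial>(M \<Otimes>\<^sub>M M))"
      by (rule complex_Re_le_cmod)
    also have "\<dots> \<le> (\<integral>z. norm (f (fst z) * g (snd z) * of_real (exp (- exp s * sqdist z))) \<partial>(M \<Otimes>\<^sub>M M))"
      by (rule integral_norm_bound)
    also have "\<dots> \<le> heat_energy s"
      unfolding heat_energy_def
    proof (rule integral_mono[OF integrable_norm Ei])
      show "integrable (M \<Otimes>\<^sub>M M) (\<lambda>z. f (fst z) * g (snd z) * complex_of_real (exp (- exp s * sqdist z)))"
        using le1[OF that(3,4)] by (intro Bochner_Integration.integrable_bound[OF Ei] AE_I2) (auto simp del: norm_mult)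
    qed (rule le1[OF that(3,4)])
    finally show ?thesis .
  qed
  have [measurable]: "(\<lambda>x. cnj (h x)) \<in> borel_measurable M"
    by (rule measurable_compose[OF assms(1)]) (intro borel_measurable_continuous_onI continuous_intros)
  have A: "has_bochner_integral freq (\<lambda>\<xi>. Re (of_real (heat s \<xi>) * (fourier h \<xi> * cofourier (\<lambda>x. cnj (h x)) \<xi>)))
     (Re (\<integral>z. h (fst z) * cnj (h (snd z)) * of_real (exp (- exp s * sqdist z)) \<partial>(M \<Otimes>\<^sub>M M)))"
    using bd by (intro has_bochner_integral_bounded_linear[OF bounded_linear_Re] heat_kernel_fourier) auto
  have B: "has_bochner_integral freq (\<lambda>\<xi>. Re (of_real (heat s \<xi>) * (fourier (\<lambda>x. cnj (h x)) \<xi> * cofourier h \<xi>)))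
     (Re (\<integral>z. cnj (h (fst z)) * h (snd z) * of_real (exp (- exp s * sqdist z)) \<partial>(M \<Otimes>\<^sub>M M)))"
    using bd by (intro has_bochner_integral_bounded_linear[OF bounded_linear_Re] heat_kernel_fourier) auto
  have eqA: "Re (of_real (heat s \<xi>) * (fourier h \<xi> * cofourier (\<lambda>x. cnj (h x)) \<xi>)) = heat s \<xi> * (norm (fourier h \<xi>))\<^sup>2" for \<xi>
    by (simp add: cofourier_cnj complex_norm_square[symmetric])
  have eqB: "Re (of_real (heat s \<xi>) * (fourier (\<lambda>x. cnj (h x)) \<xi> * cofourier h \<xi>)) = heat s \<xi> * (norm (cofourier h \<xi>))\<^sup>2" for \<xi>
    by (simp add: fourier_cnj complex_norm_square[symmetric] mult.commute[of "cnj _"])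
  have A': "integrable freq (\<lambda>\<xi>. heat s \<xi> * (norm (fourier h \<xi>))\<^sup>2)" "(\<integral>\<xi>. heat s \<xi> * (norm (fourier h \<xi>))\<^sup>2 \<partial>freq) \<le> heat_energy s"
    using A bound[of h "\<lambda>x. cnj (h x)"] bd unfolding eqA by (auto simp: has_bochner_integral_iff)
  have B': "integrable freq (\<lambda>\<xi>. heat s \<xi> * (norm (cofourier h \<xi>))\<^sup>2)" "(\<integral>\<xi>. heat s \<xi> * (norm (cofourier h \<xi>))\<^sup>2 \<partial>freq) \<le> heat_energy s"
    using B bound[of "\<lambda>x. cnj (h x)" h] bd unfolding eqB by (auto simp: has_bochner_integral_iff)
  have fourier_meas [measurable]: "(\<lambda>\<xi>. fourier h \<xi>) \<in> borel_measurable freq" "(\<lambda>\<xi>. cofourier h \<xi>) \<in> borel_measurable freq"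
    unfolding fourier_def cofourier_def by measurable
  have amgm: "heat s \<xi> * (norm (fourier h \<xi>) * norm (cofourier h \<xi>)) \<le>
     (heat s \<xi> * (norm (fourier h \<xi>))\<^sup>2 + heat s \<xi> * (norm (cofourier h \<xi>))\<^sup>2) / 2" for \<xi>
  proof -
    have "norm (fourier h \<xi>) * norm (cofourier h \<xi>) \<le> ((norm (fourier h \<xi>))\<^sup>2 + (norm (cofourier h \<xi>))\<^sup>2) / 2"
      using sum_squares_bound[of "norm (fourier h \<xi>)" "norm (cofourier h \<xi>)"] by simp
    from mult_left_mono[OF this heat_nonneg[of s \<xi>]] show ?thesis by (simp add: distrib_left)
  qed
  have gi: "integrable freq (\<lambda>\<xi>. (heat s \<xi> * (norm (fourier h \<xi>))\<^sup>2 + heat s \<xi> * (norm (cofourier h \<xi>))\<^sup>2) / 2)"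
    using A'(1) B'(1) by simp
  show *: "integrable freq (\<lambda>\<xi>. heat s \<xi> * (norm (fourier h \<xi>) * norm (cofourier h \<xi>)))"
    by (rule Bochner_Integration.integrable_bound[OF gi]) (use amgm heat_nonneg in \<open>auto simp: abs_mult intro!: AE_I2\<close>)
  have "(\<integral>\<xi>. heat s \<xi> * (norm (fourier h \<xi>) * norm (cofourier h \<xi>)) \<partial>freq)
     \<le> (\<integral>\<xi>. (heat s \<xi> * (norm (fourier h \<xi>))\<^sup>2 + heat s \<xi> * (norm (cofourier h \<xi>))\<^sup>2) / 2 \<partial>freq)"
    by (rule integral_mono[OF * gi amgm])
  also have "\<dots> \<le> heat_energy s" using A' B' by simp
  finally show "(\<integral>\<xi>. heat s \<xi> * (norm (fourier h \<xi>) * norm (cofourier h \<xi>)) \<partial>freq) \<le> heat_energy s" .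
qed

text \<open>The multiplier of \<open>D\<^sup>-\<^sup>p\<close> up to the factor \<open>\<Gamma>(p)\<close>: by Euler's integral it is a multiple of the
  power of \<open>|\<xi>|/2\<close> with exponent \<open>2p - n\<close>. Its modulus depends on the imaginary part of \<open>p\<close> only
  through \<open>\<Gamma>(n/2 - p)\<close>.\<close>

lemma gauss_weight_Mellin:
  fixes p :: complex
  assumes p: "Re p < card I / 2" and pos: "0 < (\<Sum>i\<in>I. (\<xi> i)\<^sup>2)"
  shows "has_bochner_integral lborel (\<lambda>s. exp (p * of_real s) * of_real (heat s \<xi>))
    (Gamma (card I / 2 - p) * exp (- (card I / 2 - p) * of_real (ln ((\<Sum>i\<in>I. (\<xi> i)\<^sup>2) / 4))) / of_real (sqrt (4 * pi) ^ card I))"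
proof -
  define q where "q = of_nat (card I) / 2 - p"
  define X where "X = (\<Sum>i\<in>I. (\<xi> i)\<^sup>2) / 4"
  define k where "k = complex_of_real (sqrt (4 * pi) ^ card I)"
  have q: "0 < Re q" using p by (simp add: q_def)
  have X: "0 < X" using pos by (simp add: X_def)
  have "exp (p * of_real s) * of_real (heat s \<xi>) = exp (- q * of_real s - of_real (exp (- s) * X)) / k" for s
  proof -
    have "complex_of_real (heat s \<xi>) = exp (of_real (- (card I / 2) * s)) / k * exp (of_real (- (exp (- s) * X)))"
      unfolding exp_of_real by (simp add: heat_def k_def X_def)
    then show ?thesis
      by (simp add: exp_add[symmetric] q_def algebra_simps)
  qed
  then show ?thesis
    using has_bochner_integral_divide_zero[OF has_bochner_integral_Gamma_exp_reflected[OF q X], of k]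
    by (simp add: q_def X_def k_def)
qed

lemma AE_freq_nonzero: "AE \<xi> in freq. 0 < (\<Sum>i\<in>I. (\<xi> i)\<^sup>2)"
proof (rule AE_I)
  have "emeasure freq (\<Pi>\<^sub>E i\<in>I. {0}) = (\<Prod>i\<in>I. emeasure lborel {0::real})"
    unfolding freq_def by (rule coords.emeasure_PiM[OF finite_I]) simp
  also have "\<dots> = 0" using I_ne finite_I by (simp add: card_gt_0_iff zero_power)
  finally show "emeasure freq (\<Pi>\<^sub>E i\<in>I. {0}) = 0" .
  show "(\<Pi>\<^sub>E i\<in>I. {0}) \<in> sets freq"
    unfolding freq_def by (intro sets_PiM_I_finite finite_I) simp
  show "{\<xi> \<in> space freq. \<not> 0 < (\<Sum>i\<in>I. (\<xi> i)\<^sup>2)} \<subseteq> (\<Pi>\<^sub>E i\<in>I. {0})"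
  proof (intro subsetI)
    fix \<xi> assume "\<xi> \<in> {\<xi> \<in> space freq. \<not> 0 < (\<Sum>i\<in>I. (\<xi> i)\<^sup>2)}"
    then have \<xi>: "\<xi> \<in> space freq" "\<not> 0 < (\<Sum>i\<in>I. (\<xi> i)\<^sup>2)" by auto
    then have "(\<Sum>i\<in>I. (\<xi> i)\<^sup>2) = 0"
      by (meson antisym_conv2 not_le sum_nonneg zero_le_power2)
    then have "\<forall>i\<in>I. \<xi> i = 0" using finite_I by (simp add: sum_nonneg_eq_0_iff)
    then show "\<xi> \<in> (\<Pi>\<^sub>E i\<in>I. {0})" using \<xi>(1) unfolding freq_def space_PiM PiE_iff by auto
  qed
qed

text \<open>The Riesz energy \<open>\<integral>\<integral> D\<^sup>-\<^sup>a\<close>, where \<open>D\<close> is the square of the distance.\<close>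

definition energy :: "real \<Rightarrow> real" where
  "energy a = (\<integral>z. exp (- a * ln (sqdist z)) \<partial>(M \<Otimes>\<^sub>M M))"

lemma Mellin_heat:
  fixes p :: complex and g :: "'b \<times> 'b \<Rightarrow> complex"
  assumes p: "0 < Re p"
    and pos: "AE z in M \<Otimes>\<^sub>M M. 0 < sqdist z"
    and fin: "integrable (M \<Otimes>\<^sub>M M) (\<lambda>z. exp (- Re p * ln (sqdist z)))"
    and [measurable]: "g \<in> borel_measurable (M \<Otimes>\<^sub>M M)" and g: "\<And>z. norm (g z) \<le> 1"
  shows "has_bochner_integral lborel (\<lambda>s. exp (p * of_real s) * (\<integral>z. g z * of_real (exp (- exp s * sqdist z)) \<partial>(M \<Otimes>\<^sub>M M)))
    (Gamma p * (\<integral>z. g z * exp (- p * of_real (ln (sqdist z))) \<partial>(M \<Otimes>\<^sub>M M)))"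
proof -
  define J where "J z s = g z * exp (p * of_real s - of_real (exp s * sqdist z))" for z s
  have [measurable]: "(\<lambda>(z, s). J z s) \<in> borel_measurable ((M \<Otimes>\<^sub>M M) \<Otimes>\<^sub>M lborel)"
    unfolding J_def by measurable
  have Jz: "has_bochner_integral lborel (J z) (g z * (Gamma p * exp (- p * of_real (ln (sqdist z)))))" if "0 < sqdist z" for z
    unfolding J_def by (intro has_bochner_integral_mult_right has_bochner_integral_Gamma_exp_scaled p that)
  have nJ: "norm (J z s) \<le> exp (Re p * s - exp s * sqdist z)" for z s
  proof -
    have "norm (J z s) = norm (g z) * exp (Re p * s - exp s * sqdist z)"
      by (simp add: J_def norm_mult)
    also have "\<dots> \<le> 1 * exp (Re p * s - exp s * sqdist z)" by (intro mult_right_mono g) simp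
    finally show ?thesis by simp
  qed
  have int_nJ: "(\<integral>s. norm (J z s) \<partial>lborel) \<le> Gamma (Re p) * exp (- Re p * ln (sqdist z))" if "0 < sqdist z" for z
  proof -
    note R = has_bochner_integral_Gamma_exp_scaled_real[OF p that]
    have "(\<integral>s. norm (J z s) \<partial>lborel) \<le> (\<integral>s. exp (Re p * s - exp s * sqdist z) \<partial>lborel)"
      using Jz[OF that] R by (intro integral_mono nJ integrable_norm) (auto simp: has_bochner_integral_iff)
    also have "\<dots> = Gamma (Re p) * exp (- Re p * ln (sqdist z))" using R by (simp add: has_bochner_integral_iff)
    finally show ?thesis .
  qed
  have JI: "integrable ((M \<Otimes>\<^sub>M M) \<Otimes>\<^sub>M lborel) (\<lambda>(z, s). J z s)"
  proof (rule MM_lborel.Fubini_integrable, goal_cases)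
    case 1
    show ?case by measurable
  next
    case 2
    have "integrable (M \<Otimes>\<^sub>M M) (\<lambda>z. Gamma (Re p) * exp (- Re p * ln (sqdist z)))"
      using fin by simp
    then show ?case
    proof (rule Bochner_Integration.integrable_bound)
      show "AE z in M \<Otimes>\<^sub>M M. norm (\<integral>s. norm (case (z, s) of (z, s) \<Rightarrow> J z s) \<partial>lborel) \<le> norm (Gamma (Re p) * exp (- Re p * ln (sqdist z)))"
        using pos
      proof eventually_elim
        case (elim z)
        have "0 \<le> (\<integral>s. norm (J z s) \<partial>lborel)" by simp
        then show ?case using int_nJ[OF elim] by simp
      qed
    qed measurable
  next
    case 3
    show ?case using pos
      by eventually_elim (use Jz in \<open>auto simp: has_bochner_integral_iff\<close>)
  qed
  have in_z: "(\<integral>z. J z s \<partial>(M \<Otimes>\<^sub>M M)) = exp (p * of_real s) * (\<integral>z. g z * of_real (exp (- exp s * sqdist z)) \<partial>(M \<Otimes>\<^sub>M M))" for s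
  proof -
    have "J z s = exp (p * of_real s) * (g z * of_real (exp (- exp s * sqdist z)))" for z
      by (simp add: J_def exp_diff exp_minus exp_of_real[symmetric] field_simps)
    then show ?thesis by (simp only: integral_mult_right_zero)
  qed
  have "(\<integral>s. \<integral>z. J z s \<partial>(M \<Otimes>\<^sub>M M) \<partial>lborel) = (\<integral>z. \<integral>s. J z s \<partial>lborel \<partial>(M \<Otimes>\<^sub>M M))"
    by (rule MM_lborel.Fubini_integral[OF JI])
  also have "\<dots> = (\<integral>z. Gamma p * (g z * exp (- p * of_real (ln (sqdist z)))) \<partial>(M \<Otimes>\<^sub>M M))"
  proof (rule integral_cong_AE)
    show "AE z in M \<Otimes>\<^sub>M M. (\<integral>s. J z s \<partial>lborel) = Gamma p * (g z * exp (- p * of_real (ln (sqdist z))))"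
      using pos by eventually_elim (use Jz in \<open>auto simp: has_bochner_integral_iff mult_ac\<close>)
  qed measurable
  also have "\<dots> = Gamma p * (\<integral>z. g z * exp (- p * of_real (ln (sqdist z))) \<partial>(M \<Otimes>\<^sub>M M))"
    by (rule integral_mult_right_zero)
  finally have "(\<integral>s. \<integral>z. J z s \<partial>(M \<Otimes>\<^sub>M M) \<partial>lborel) = \<dots>" .
  with MM_lborel.integrable_snd[OF JI] show ?thesis
    unfolding in_z by (simp add: has_bochner_integral_iff)
qed

text \<open>Going over to complex exponents costs only a quotient of Gamma values. Write \<open>\<Gamma>(p) D\<^sup>-\<^sup>p\<close> as
  an integral over Gaussians and pass to frequencies. The integral over \<open>s\<close> and \<open>\<xi>\<close> converges
  absolutely; its absolute integral is at most \<open>\<Gamma>(a) energy a\<close>, by the positivity in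
  \<open>heat_fourier_le\<close>. Integrating over \<open>s\<close> first gives, for every \<open>\<xi>\<close>, the multiplier of order \<open>p\<close>,
  which has \<open>R\<close> times the modulus of that of order \<open>a\<close>.\<close>

theorem energy_Mellin_bound:
  fixes p :: complex and h :: "'b \<Rightarrow> complex"
  assumes p: "0 < Re p" "Re p < card I / 2"
    and pos: "AE z in M \<Otimes>\<^sub>M M. 0 < sqdist z"
    and fin: "integrable (M \<Otimes>\<^sub>M M) (\<lambda>z. exp (- Re p * ln (sqdist z)))"
    and [measurable]: "h \<in> borel_measurable M" and h: "\<And>x. norm (h x) \<le> 1"
  shows "norm (Gamma p) * norm (\<integral>z. h (fst z) * h (snd z) * exp (- p * of_real (ln (sqdist z))) \<partial>(M \<Otimes>\<^sub>M M))
     \<le> norm (Gamma (card I / 2 - p)) / Gamma (card I / 2 - Re p) * Gamma (Re p) * energy (Re p)"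
proof -
  define a where "a = Re p"
  define n2 where "n2 = card I / 2"
  define R where "R = norm (Gamma (of_real n2 - p)) / Gamma (n2 - a)"
  have a: "0 < a" "a < n2" using p by (auto simp: a_def n2_def)
  have Gpos: "0 < Gamma (n2 - a)" using a by (intro Gamma_real_pos) simp
  have R: "0 \<le> R" using Gpos by (simp add: R_def)
  have [measurable]: "(\<lambda>\<xi>. fourier h \<xi>) \<in> borel_measurable freq" "(\<lambda>\<xi>. cofourier h \<xi>) \<in> borel_measurable freq"
    unfolding fourier_def cofourier_def by measurable
  define AB where "AB \<xi> = fourier h \<xi> * cofourier h \<xi>" for \<xi>
  have [measurable]: "AB \<in> borel_measurable freq" unfolding AB_def by measurable
  define K where "K s \<xi> = exp (p * of_real s) * of_real (heat s \<xi>) * AB \<xi>" for s \<xi>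
  have [measurable]: "(\<lambda>(s, \<xi>). K s \<xi>) \<in> borel_measurable (lborel \<Otimes>\<^sub>M freq)"
    unfolding K_def by measurable
  have nK: "norm (K s \<xi>) = exp (a * s) * (heat s \<xi> * (norm (fourier h \<xi>) * norm (cofourier h \<xi>)))" for s \<xi>
    by (simp add: K_def AB_def norm_mult a_def heat_nonneg)
  have hh: "norm (h (fst z) * h (snd z)) \<le> 1" for z
    using h by (auto simp: norm_mult intro!: mult_le_one)
  have K\<xi>: "has_bochner_integral freq (K s) (exp (p * of_real s) * (\<integral>z. h (fst z) * h (snd z) * of_real (exp (- exp s * sqdist z)) \<partial>(M \<Otimes>\<^sub>M M)))" for s
    unfolding K_def AB_def mult.assoc[of "exp _"]
    by (intro has_bochner_integral_mult_right heat_kernel_fourier h) measurable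
  \<comment> \<open>The real case of \<open>Mellin_heat\<close>, with \<open>g = 1\<close>.\<close>
  have E: "has_bochner_integral lborel (\<lambda>s. exp (a * s) * heat_energy s) (Gamma a * energy a)"
  proof -
    have "has_bochner_integral lborel (\<lambda>s. Re (exp (of_real a * of_real s) * (\<integral>z. 1 * of_real (exp (- exp s * sqdist z)) \<partial>(M \<Otimes>\<^sub>M M))))
      (Re (Gamma (of_real a) * (\<integral>z. 1 * exp (- of_real a * of_real (ln (sqdist z))) \<partial>(M \<Otimes>\<^sub>M M))))"
      using a fin pos
      by (intro has_bochner_integral_bounded_linear[OF bounded_linear_Re] Mellin_heat) (auto simp: a_def)
    moreover have "(\<integral>z. 1 * complex_of_real (exp (- exp s * sqdist z)) \<partial>(M \<Otimes>\<^sub>M M)) = of_real (heat_energy s)" for s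
      by (simp only: mult_1 integral_complex_of_real heat_energy_def)
    moreover have "(\<integral>z. 1 * exp (- of_real a * complex_of_real (ln (sqdist z))) \<partial>(M \<Otimes>\<^sub>M M)) = of_real (energy a)"
    proof -
      have "1 * exp (- of_real a * complex_of_real (ln (sqdist z))) = of_real (exp (- a * ln (sqdist z)))" for z
        by (simp flip: exp_of_real)
      then show ?thesis by (simp only: integral_complex_of_real energy_def)
    qed
    moreover have "exp (of_real a * of_real s) = complex_of_real (exp (a * s))" for s by (simp flip: exp_of_real)
    ultimately show ?thesis
      by (simp only: Gamma_complex_of_real of_real_mult[symmetric] Re_complex_of_real)
  qed
  have int_nK: "(\<integral>\<xi>. norm (K s \<xi>) \<partial>freq) \<le> exp (a * s) * heat_energy s" for s
    unfolding nK integral_mult_right_zero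
    by (intro mult_left_mono heat_fourier_le(2) h) auto
  have KI: "integrable (lborel \<Otimes>\<^sub>M freq) (\<lambda>(s, \<xi>). K s \<xi>)"
  proof (rule lborel_freq.Fubini_integrable, goal_cases)
    case 1
    show ?case by measurable
  next
    case 2
    have "integrable lborel (\<lambda>s. exp (a * s) * heat_energy s)" using E by (simp add: has_bochner_integral_iff)
    then show ?case
    proof (rule Bochner_Integration.integrable_bound)
      show "AE s in lborel. norm (\<integral>\<xi>. norm (case (s, \<xi>) of (s, \<xi>) \<Rightarrow> K s \<xi>) \<partial>freq) \<le> norm (exp (a * s) * heat_energy s)"
      proof (intro AE_I2)
        fix s
        have "0 \<le> (\<integral>\<xi>. norm (K s \<xi>) \<partial>freq)" by simp
        then show "norm (\<integral>\<xi>. norm (case (s, \<xi>) of (s, \<xi>) \<Rightarrow> K s \<xi>) \<partial>freq) \<le> norm (exp (a * s) * heat_energy s)"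
          using int_nK[of s] by simp
      qed
    qed measurable
  next
    case 3
    show ?case using K\<xi> by (simp add: has_bochner_integral_iff)
  qed
  have KN: "integrable (lborel \<Otimes>\<^sub>M freq) (\<lambda>(s, \<xi>). norm (K s \<xi>))"
    using integrable_norm[OF KI] by (simp add: case_prod_beta')
  \<comment> \<open>The gain: on each frequency the cancellation in \<open>s\<close> amounts to the factor \<open>R\<close>.\<close>
  have inner: "AE \<xi> in freq. norm (\<integral>s. K s \<xi> \<partial>lborel) = R * (\<integral>s. norm (K s \<xi>) \<partial>lborel)"
    using AE_freq_nonzero
  proof eventually_elim
    case (elim \<xi>)
    define X where "X = (\<Sum>i\<in>I. (\<xi> i)\<^sup>2) / 4"
    define k where "k = sqrt (4 * pi) ^ card I"
    have k: "0 < k" by (simp add: k_def)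
    have 1: "(\<integral>s. exp (p * of_real s) * of_real (heat s \<xi>) \<partial>lborel) = Gamma (of_real n2 - p) * exp (- (of_real n2 - p) * of_real (ln X)) / of_real k"
      using gauss_weight_Mellin[OF p(2) elim] by (simp add: has_bochner_integral_iff X_def k_def n2_def)
    have 2: "(\<integral>s. exp (of_real a * of_real s) * of_real (heat s \<xi>) \<partial>lborel) = Gamma (of_real n2 - of_real a) * exp (- (of_real n2 - of_real a) * of_real (ln X)) / complex_of_real k"
      using gauss_weight_Mellin[of "of_real a" \<xi>] elim a by (simp add: has_bochner_integral_iff X_def k_def n2_def)
    have "complex_of_real (\<integral>s. exp (a * s) * heat s \<xi> \<partial>lborel) = (\<integral>s. exp (of_real a * of_real s) * of_real (heat s \<xi>) \<partial>lborel)"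
      unfolding integral_complex_of_real[symmetric] by (simp flip: exp_of_real)
    also have "\<dots> = complex_of_real (Gamma (n2 - a) * exp (- (n2 - a) * ln X) / k)"
      unfolding 2 by (simp add: Gamma_complex_of_real[symmetric] exp_of_real[symmetric])
    finally have 3: "(\<integral>s. exp (a * s) * heat s \<xi> \<partial>lborel) = Gamma (n2 - a) * exp (- (n2 - a) * ln X) / k"
      by (simp only: of_real_eq_iff)
    have "norm (\<integral>s. K s \<xi> \<partial>lborel) = norm (\<integral>s. exp (p * of_real s) * of_real (heat s \<xi>) \<partial>lborel) * norm (AB \<xi>)"
      unfolding K_def integral_mult_left_zero norm_mult ..
    also have "\<dots> = R * (\<integral>s. exp (a * s) * heat s \<xi> \<partial>lborel) * norm (AB \<xi>)"
      unfolding 1 3 using k Gpos by (simp add: norm_mult norm_divide R_def a_def)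
    also have "\<dots> = R * (\<integral>s. exp (a * s) * heat s \<xi> * norm (AB \<xi>) \<partial>lborel)"
      by (subst integral_mult_left_zero) (rule mult.assoc)
    also have "(\<integral>s. exp (a * s) * heat s \<xi> * norm (AB \<xi>) \<partial>lborel) = (\<integral>s. norm (K s \<xi>) \<partial>lborel)"
      by (simp only: nK AB_def norm_mult mult.assoc)
    finally show ?case .
  qed
  have "Gamma p * (\<integral>z. h (fst z) * h (snd z) * exp (- p * of_real (ln (sqdist z))) \<partial>(M \<Otimes>\<^sub>M M))
     = (\<integral>s. \<integral>\<xi>. K s \<xi> \<partial>freq \<partial>lborel)"
  proof -
    have "(\<integral>s. \<integral>\<xi>. K s \<xi> \<partial>freq \<partial>lborel) = (\<integral>s. exp (p * of_real s) * (\<integral>z. h (fst z) * h (snd z) * of_real (exp (- exp s * sqdist z)) \<partial>(M \<Otimes>\<^sub>M M)) \<partial>lborel)"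
      using K\<xi> by (simp add: has_bochner_integral_iff)
    also have "\<dots> = Gamma p * (\<integral>z. h (fst z) * h (snd z) * exp (- p * of_real (ln (sqdist z))) \<partial>(M \<Otimes>\<^sub>M M))"
      using Mellin_heat[OF p(1) pos fin _ hh] by (simp add: has_bochner_integral_iff)
    finally show ?thesis ..
  qed
  also have "\<dots> = (\<integral>\<xi>. \<integral>s. K s \<xi> \<partial>lborel \<partial>freq)"
    by (rule lborel_freq.Fubini_integral[OF KI, symmetric])
  finally have "norm (Gamma p * (\<integral>z. h (fst z) * h (snd z) * exp (- p * of_real (ln (sqdist z))) \<partial>(M \<Otimes>\<^sub>M M)))
     = norm (\<integral>\<xi>. \<integral>s. K s \<xi> \<partial>lborel \<partial>freq)"
    by (rule arg_cong)
  also have "\<dots> \<le> (\<integral>\<xi>. norm (\<integral>s. K s \<xi> \<partial>lborel) \<partial>freq)" by (rule integral_norm_bound)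
  also have "\<dots> = (\<integral>\<xi>. R * (\<integral>s. norm (K s \<xi>) \<partial>lborel) \<partial>freq)"
    by (rule integral_cong_AE[OF _ _ inner]) measurable
  also have "\<dots> = R * (\<integral>\<xi>. \<integral>s. norm (K s \<xi>) \<partial>lborel \<partial>freq)" by (rule integral_mult_right_zero)
  also have "(\<integral>\<xi>. \<integral>s. norm (K s \<xi>) \<partial>lborel \<partial>freq) = (\<integral>s. \<integral>\<xi>. norm (K s \<xi>) \<partial>freq \<partial>lborel)"
    by (rule lborel_freq.Fubini_integral[OF KN])
  also have "R * \<dots> \<le> R * (Gamma a * energy a)"
  proof (rule mult_left_mono[OF _ R])
    have "(\<integral>s. \<integral>\<xi>. norm (K s \<xi>) \<partial>freq \<partial>lborel) \<le> (\<integral>s. exp (a * s) * heat_energy s \<partial>lborel)"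
      using E lborel_freq.integrable_fst[OF KN] by (intro integral_mono int_nK) (auto simp: has_bochner_integral_iff)
    then show "(\<integral>s. \<integral>\<xi>. norm (K s \<xi>) \<partial>freq \<partial>lborel) \<le> Gamma a * energy a"
      using E by (simp add: has_bochner_integral_iff)
  qed
  finally show ?thesis unfolding norm_mult by (simp add: R_def a_def n2_def mult.assoc)
qed

end

section \<open>Logarithms of distances\<close>

context measured_points
begin

lemma sqdist_ball_meas [measurable]:
  "x \<in> space M \<Longrightarrow> {y \<in> space M. sqdist (x, y) \<le> c} \<in> sets M"
  by measurable

text \<open>The set of all \<open>y\<close> with the same image as \<open>x\<close> lies in balls of arbitrarily small radius.\<close>

lemma sqdist_pos_AE:
  assumes t: "0 < t" and C: "0 \<le> C"
    and ball: "\<And>x r. x \<in> space M \<Longrightarrow> 0 < r \<Longrightarrow> r \<le> 1 \<Longrightarrow> measure M {y \<in> space M. sqdist (x, y) \<le> r\<^sup>2} \<le> C * r powr t"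
  shows "AE z in M \<Otimes>\<^sub>M M. 0 < sqdist z"
proof (rule pair.AE_pair_measure[where P = "\<lambda>z. 0 < sqdist z"])
  show "AE x in M. AE y in M. 0 < sqdist (x, y)"
  proof (rule AE_I2)
    fix x assume x: "x \<in> space M"
    have "(\<lambda>j. C * (1 / 2 ^ j) powr t) \<longlonglongrightarrow> 0"
    proof -
      have "(\<lambda>j. C * (2 powr (-t)) ^ j) \<longlonglongrightarrow> C * 0"
        using t by (intro tendsto_intros LIMSEQ_power_zero) (simp add: powr_minus inverse_eq_divide)
      moreover have "(1 / 2 ^ j) powr t = (2 powr (-t)) ^ j" for j :: nat
        by (simp add: powr_divide powr_minus powr_powr powr_realpow[symmetric] powr_power inverse_eq_divide power_divide mult.commute)
      ultimately show ?thesis by simp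
    qed
    moreover have "measure M {y \<in> space M. sqdist (x, y) \<le> 0} \<le> C * (1 / 2 ^ j) powr t" for j
    proof -
      have "measure M {y \<in> space M. sqdist (x, y) \<le> 0} \<le> measure M {y \<in> space M. sqdist (x, y) \<le> (1 / 2 ^ j)\<^sup>2}"
        using x by (intro finite_measure_mono) (auto intro: order_trans)
      also have "\<dots> \<le> C * (1 / 2 ^ j) powr t" using x by (intro ball) auto
      finally show ?thesis .
    qed
    ultimately have "measure M {y \<in> space M. sqdist (x, y) \<le> 0} \<le> 0"
      by (intro LIMSEQ_le_const) auto
    then have "emeasure M {y \<in> space M. sqdist (x, y) \<le> 0} = 0"
      by (simp add: emeasure_eq_measure measure_le_0_iff)
    then show "AE y in M. 0 < sqdist (x, y)"
      using x by (intro AE_I[where N = "{y \<in> space M. sqdist (x, y) \<le> 0}"]) auto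
  qed
qed measurable

text \<open>Sum over dyadic shells around \<open>x\<close>: the shell of radius \<open>2\<^sup>-\<^sup>j\<close> contributes at most a multiple
  of \<open>2\<^sup>2\<^sup>a\<^sup>j 2\<^sup>-\<^sup>j\<^sup>t\<close>, a geometric series. The null set \<open>D = 0\<close>, on which the integrand is \<open>1\<close>
  because \<open>ln 0 = 0\<close>, belongs to no shell and is discarded first.\<close>

lemma energy_finite:
  assumes a: "0 < a" "2 * a < t" and C: "0 \<le> C"
    and ball: "\<And>x r. x \<in> space M \<Longrightarrow> 0 < r \<Longrightarrow> r \<le> 1 \<Longrightarrow> measure M {y \<in> space M. sqdist (x, y) \<le> r\<^sup>2} \<le> C * r powr t"
  shows "integrable (M \<Otimes>\<^sub>M M) (\<lambda>z. exp (- a * ln (sqdist z)))"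
proof -
  define c where "c j = 4 powr (a * (real j + 1))" for j
  define B where "B x j = {y \<in> space M. sqdist (x, y) \<le> (1 / 2 ^ j)\<^sup>2}" for x j
  define b where "b j = c j * (C * (1 / 2 ^ j) powr t)" for j
  have b0: "0 \<le> b j" for j using C by (simp add: b_def c_def)
  have "summable b"
  proof -
    have "b j = (4 powr a * C) * (2 powr (2 * a - t)) ^ j" for j
    proof -
      have "c j = 4 powr a * (2 powr (2 * a)) ^ j"
      proof -
        have "(4::real) powr (a * real j) = (2 powr 2) powr (a * real j)" by simp
        also have "\<dots> = (2 powr (2 * a)) powr real j" by (simp only: powr_powr mult.assoc)
        also have "\<dots> = (2 powr (2 * a)) ^ j" by (simp add: powr_realpow)
        finally show ?thesis by (simp add: c_def distrib_left powr_add)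
      qed
      moreover have "(1 / 2 ^ j) powr t = (2 powr (-t)) ^ j"
      proof -
        have "(1 / 2 ^ j) powr t = (2 powr (- real j)) powr t" by (simp add: powr_minus powr_realpow inverse_eq_divide)
        also have "\<dots> = (2 powr (-t)) powr real j" by (simp add: powr_powr mult.commute)
        finally show ?thesis by (simp add: powr_realpow)
      qed
      moreover have "(2::real) powr (2 * a - t) = 2 powr (2 * a) * 2 powr (-t)" by (simp flip: powr_add)
      ultimately show ?thesis by (simp add: b_def power_mult_distrib)
    qed
    then have "b = (\<lambda>j. (4 powr a * C) * (2 powr (2 * a - t)) ^ j)" by (rule ext)
    moreover have "2 powr (2 * a - t) < 2 powr (0::real)" using a by (intro powr_less_mono) auto
    then have "summable (\<lambda>j. (4 powr a * C) * (2 powr (2 * a - t)) ^ j)"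
      by (intro summable_mult summable_geometric) simp
    ultimately show ?thesis by (simp only:)
  qed
  then have fin: "(\<Sum>j. ennreal (b j)) \<noteq> top" using b0 by (rule ennreal_suminf_neq_top)
  note pos = sqdist_pos_AE[of t C, OF _ C ball]
  have inner: "(\<integral>\<^sup>+y. ennreal (if sqdist (x, y) = 0 then 0 else exp (- a * ln (sqdist (x, y)))) \<partial>M) \<le> emeasure M (space M) + (\<Sum>j. ennreal (b j))"
    if x: "x \<in> space M" for x
  proof -
    have [measurable]: "B x j \<in> sets M" for j unfolding B_def using x by measurable
    have pt: "ennreal (if sqdist (x, y) = 0 then 0 else exp (- a * ln (sqdist (x, y)))) \<le> 1 + (\<Sum>j. ennreal (c j) * indicator (B x j) y)"
      if y: "y \<in> space M" for y
    proof (cases "sqdist (x, y) = 0")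
      case False
      define D where "D = sqdist (x, y)"
      have D: "0 < D" using False sqdist_nonneg[of "(x, y)"] by (simp add: D_def)
      show ?thesis
      proof (cases "1 \<le> D")
        case True
        then have "exp (- a * ln D) \<le> 1" using a by simp
        then have "ennreal (exp (- a * ln D)) \<le> 1" by simp
        also have "\<dots> \<le> 1 + (\<Sum>j. ennreal (c j) * indicator (B x j) y)" by simp
        finally show ?thesis using False by (simp add: D_def)
      next
        case D1: False
        define j where "j = (LEAST j. (1/4::real) ^ (j + 1) < D)"
        obtain i where "(1/4::real) ^ i < D" using real_arch_pow_inv[of D "1/4"] D by auto
        moreover have "(1/4::real) ^ (i + 1) \<le> (1/4) ^ i" by (intro power_decreasing) auto
        ultimately have "\<exists>j. (1/4::real) ^ (j + 1) < D" by (intro exI[of _ i]) linarith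
        then have j1: "(1/4::real) ^ (j + 1) < D" unfolding j_def by (rule LeastI_ex)
        have j2: "D \<le> (1/4) ^ j"
        proof (cases j)
          case (Suc i)
          then have "\<not> (1/4::real) ^ (i + 1) < D" unfolding j_def by (intro not_less_Least) simp
          then show ?thesis using Suc by simp
        qed (use D1 in simp)
        have "exp (- a * ln D) \<le> c j"
        proof -
          have "- ln D \<le> - ln ((1/4) ^ (j + 1))" using j1 D by simp
          also have "\<dots> = (real j + 1) * ln 4" by (simp add: ln_realpow ln_div algebra_simps)
          finally have "a * (- ln D) \<le> a * ((real j + 1) * ln 4)" using a by (intro mult_left_mono) auto
          then show ?thesis by (simp add: c_def powr_def mult_ac)
        qed
        moreover have "y \<in> B x j" 
        proof -
          have "(1 / 2 ^ j)\<^sup>2 = ((1 / 2)\<^sup>2 :: real) ^ j"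
            by (simp only: power_one_over[symmetric] power_mult[symmetric] mult.commute)
          also have "\<dots> = (1 / 4) ^ j" by (simp add: power2_eq_square)
          finally show ?thesis using y j2 by (simp add: B_def D_def)
        qed
        ultimately have "ennreal (exp (- a * ln D)) \<le> ennreal (c j) * indicator (B x j) y" by (simp add: ennreal_leI)
        also have "\<dots> \<le> (\<Sum>i. ennreal (c i) * indicator (B x i) y)"
        proof -
          define F where "F i = ennreal (c i) * indicator (B x i) y" for i
          have "F j = sum F {j}" by simp
          also have "\<dots> \<le> suminf F" by (intro sum_le_suminf) auto
          finally show ?thesis unfolding F_def .
        qed
        also have "\<dots> \<le> 1 + \<dots>" by (simp add: add_increasing)
        finally show ?thesis using False by (simp add: D_def)
      qed
    qed simp
    have "(\<integral>\<^sup>+y. ennreal (if sqdist (x, y) = 0 then 0 else exp (- a * ln (sqdist (x, y)))) \<partial>M)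
      \<le> (\<integral>\<^sup>+y. 1 + (\<Sum>j. ennreal (c j) * indicator (B x j) y) \<partial>M)"
      by (intro nn_integral_mono pt)
    also have "\<dots> = emeasure M (space M) + (\<Sum>j. ennreal (c j) * emeasure M (B x j))"
      by (subst nn_integral_add) (auto simp: nn_integral_suminf nn_integral_cmult_indicator)
    also have "\<dots> \<le> emeasure M (space M) + (\<Sum>j. ennreal (b j))"
    proof (intro add_left_mono suminf_le)
      show "ennreal (c j) * emeasure M (B x j) \<le> ennreal (b j)" for j
      proof -
        have "emeasure M (B x j) \<le> ennreal (C * (1 / 2 ^ j) powr t)"
          unfolding emeasure_eq_measure B_def using ball[OF x, of "1 / 2 ^ j"] by (intro ennreal_leI) simp
        then have "ennreal (c j) * emeasure M (B x j) \<le> ennreal (c j) * ennreal (C * (1 / 2 ^ j) powr t)"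
          by (intro mult_left_mono) auto
        then show ?thesis using C by (simp add: b_def ennreal_mult c_def)
      qed
    qed auto
    finally show ?thesis .
  qed
  have "(\<integral>\<^sup>+z. ennreal (if sqdist z = 0 then 0 else exp (- a * ln (sqdist z))) \<partial>(M \<Otimes>\<^sub>M M))
     = (\<integral>\<^sup>+x. \<integral>\<^sup>+y. ennreal (if sqdist (x, y) = 0 then 0 else exp (- a * ln (sqdist (x, y)))) \<partial>M \<partial>M)"
    by (rule nn_integral_fst[symmetric]) measurable
  also have "\<dots> \<le> (\<integral>\<^sup>+x. emeasure M (space M) + (\<Sum>j. ennreal (b j)) \<partial>M)"
    by (intro nn_integral_mono inner)
  also have "\<dots> = (emeasure M (space M) + (\<Sum>j. ennreal (b j))) * emeasure M (space M)" by simp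
  also have "\<dots> < \<infinity>"
    using fin by (simp add: ennreal_mult_less_top less_top emeasure_eq_measure)
  finally have "integrable (M \<Otimes>\<^sub>M M) (\<lambda>z. if sqdist z = 0 then 0 else exp (- a * ln (sqdist z)))"
    by (intro integrableI_nonneg) auto
  moreover have "AE z in M \<Otimes>\<^sub>M M. (if sqdist z = 0 then 0 else exp (- a * ln (sqdist z))) = exp (- a * ln (sqdist z))"
    using pos a by (auto elim!: eventually_mono)
  ultimately show ?thesis
    by (subst (asm) integrable_cong_AE) auto
qed

text \<open>The additive function \<open>\<kappa>\<close> of one point only contributes a unimodular factor to the
  characteristic function, so \<open>energy_Mellin_bound\<close> applies. The exponent \<open>a\<close> is chosen such that
  \<open>2a = n/2 + 1 + \<epsilon>\<close>, and then the quotient of Gamma values decays like \<open>|t|\<^sup>-\<^sup>1\<^sup>-\<^sup>\<epsilon>\<close>.\<close>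

lemma log_distances_somewhere_dense:
  fixes \<kappa> :: "'b \<Rightarrow> real" and \<epsilon> :: real
  defines "a \<equiv> card I / 4 + (1 + \<epsilon>) / 2"
  assumes [measurable]: "\<kappa> \<in> borel_measurable M"
    and \<epsilon>: "0 < \<epsilon>" "\<epsilon> < 1" and a: "a < card I / 2"
    and pos: "AE z in M \<Otimes>\<^sub>M M. 0 < sqdist z"
    and fin: "integrable (M \<Otimes>\<^sub>M M) (\<lambda>z. exp (- a * ln (sqdist z)))"
    and M_pos: "0 < measure M (space M)"
  obtains l r where "l < r" "\<And>s t. l \<le> s \<Longrightarrow> s < t \<Longrightarrow> t \<le> r \<Longrightarrow>
    \<exists>x\<in>space M. \<exists>y\<in>space M. 0 < sqdist (x, y) \<and> ln (sqdist (x, y)) + \<kappa> x + \<kappa> y \<in> {s<..t}"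
proof -
  have a0: "0 < a" using \<epsilon> by (simp add: a_def add_nonneg_pos)
  define w where "w z = exp (- a * ln (sqdist z)) / energy a" for z
  define T where "T z = ln (sqdist z) + \<kappa> (fst z) + \<kappa> (snd z)" for z
  have [measurable]: "w \<in> borel_measurable (M \<Otimes>\<^sub>M M)" "T \<in> borel_measurable (M \<Otimes>\<^sub>M M)"
    unfolding w_def T_def by measurable
  have MM_pos: "emeasure (M \<Otimes>\<^sub>M M) (space (M \<Otimes>\<^sub>M M)) \<noteq> 0"
    using M_pos unfolding space_pair_measure by (subst emeasure_pair_measure_Times) (auto simp: emeasure_eq_measure)
  have E: "0 < energy a"
  proof -
    have "energy a \<noteq> 0"
    proof
      assume "energy a = 0"
      then have "AE z in M \<Otimes>\<^sub>M M. exp (- a * ln (sqdist z)) = 0"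
        using integral_nonneg_eq_0_iff_AE[OF fin] by (simp add: energy_def)
      then have "AE z in M \<Otimes>\<^sub>M M. False" by simp
      then show False using MM_pos by (simp add: AE_iff_null null_sets_def)
    qed
    moreover have "0 \<le> energy a" by (simp add: energy_def)
    ultimately show ?thesis by simp
  qed
  \<comment> \<open>The law of the expression under the normalised weight \<open>D\<^sup>-\<^sup>a\<close>.\<close>
  define Q where "Q = density (M \<Otimes>\<^sub>M M) (\<lambda>z. ennreal (w z))"
  define N where "N = distr Q borel T"
  have [measurable]: "T \<in> borel_measurable Q" by (simp add: Q_def)
  have w0: "0 \<le> w z" for z using E by (simp add: w_def)
  have wi: "integrable (M \<Otimes>\<^sub>M M) w" unfolding w_def using fin by simp
  have "integral\<^sup>L (M \<Otimes>\<^sub>M M) w = 1"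
    unfolding w_def using E by (simp add: energy_def)
  then have "(\<integral>\<^sup>+z. ennreal (w z) \<partial>(M \<Otimes>\<^sub>M M)) = 1"
    using nn_integral_eq_integral[OF wi] w0 by simp
  then have "emeasure Q (space Q) = 1"
    unfolding Q_def by (subst emeasure_density) (auto simp: space_density cong: nn_integral_cong)
  then interpret Q: prob_space Q by (rule prob_spaceI)
  interpret N: real_distribution N
    unfolding N_def by (rule Q.real_distribution_distr) measurable
  have char: "char N t = (\<integral>z. iexp (t * \<kappa> (fst z)) * iexp (t * \<kappa> (snd z)) * exp (- Complex a (- t) * of_real (ln (sqdist z))) \<partial>(M \<Otimes>\<^sub>M M)) / energy a" for t
  proof -
    have "char N t = (\<integral>z. iexp (t * T z) \<partial>Q)"
      unfolding char_def N_def by (subst integral_distr) auto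
    also have "\<dots> = (\<integral>z. w z *\<^sub>R iexp (t * T z) \<partial>(M \<Otimes>\<^sub>M M))"
      unfolding Q_def by (subst integral_density) (auto simp: w0)
    also have "\<dots> = (\<integral>z. iexp (t * \<kappa> (fst z)) * iexp (t * \<kappa> (snd z)) * exp (- Complex a (- t) * of_real (ln (sqdist z))) / energy a \<partial>(M \<Otimes>\<^sub>M M))"
    proof (intro Bochner_Integration.integral_cong refl)
      fix z
      have "complex_of_real (exp (- a * ln (sqdist z))) * iexp (t * T z) =
          iexp (t * \<kappa> (fst z)) * iexp (t * \<kappa> (snd z)) * exp (- Complex a (- t) * of_real (ln (sqdist z)))"
        unfolding exp_of_real[symmetric] exp_add[symmetric]
        by (intro arg_cong[where f = exp]) (simp add: T_def complex_eq_iff algebra_simps)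
      then show "w z *\<^sub>R iexp (t * T z) = iexp (t * \<kappa> (fst z)) * iexp (t * \<kappa> (snd z)) * exp (- Complex a (- t) * of_real (ln (sqdist z))) / energy a"
        by (simp add: w_def scaleR_conv_of_real)
    qed
    finally show ?thesis by simp
  qed
  \<comment> \<open>The numerator \<open>\<Gamma>(n/2 - p)\<close> lives on the line with real part \<open>q\<close>, the denominator \<open>\<Gamma>(p)\<close> a
    distance \<open>1 + \<epsilon>\<close> further right.\<close>
  define q where "q = card I / 2 - a"
  have "2 * a = card I / 2 + 1 + \<epsilon>" by (simp add: a_def field_simps)
  then have q: "0 < q" "q + 1 + \<epsilon> = a" using a unfolding q_def by linarith+
  obtain C where C: "0 < C" "\<And>y. norm (Gamma (Complex q y)) / norm (Gamma (Complex a y)) \<le> C * norm (Complex q y) powr (- (1 + \<epsilon>))"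
    using Gamma_ratio_bound[OF q(1) \<epsilon>] unfolding q(2) by blast
  define K where "K = Gamma a / Gamma q * C"
  have bound: "norm (char N t) \<le> K * norm (Complex q t) powr (- (1 + \<epsilon>))" for t
  proof -
    have "Complex a (- t) \<notin> \<int>\<^sub>\<le>\<^sub>0"
      using a0 by (auto simp: complex_eq_iff elim!: nonpos_Ints_cases)
    then have Gp: "0 < norm (Gamma (Complex a (- t)))"
      by (simp add: Gamma_eq_zero_iff)
    have Gq: "0 < Gamma q" "0 < Gamma a" using q a0 by (auto intro: Gamma_real_pos)
    have "norm (Gamma (Complex a (- t))) * (energy a * norm (char N t)) \<le> norm (Gamma (Complex q t)) / Gamma q * Gamma a * energy a"
    proof -
      have "card I / 2 - Complex a (- t) = Complex q t" by (simp add: q_def complex_eq_iff)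
      moreover have "card I / 2 - Re (Complex a (- t)) = q" by (simp add: q_def)
      moreover have "energy a * norm (char N t) = norm (\<integral>z. iexp (t * \<kappa> (fst z)) * iexp (t * \<kappa> (snd z)) * exp (- Complex a (- t) * of_real (ln (sqdist z))) \<partial>(M \<Otimes>\<^sub>M M))"
        unfolding char norm_divide using E by simp
      ultimately show ?thesis
        using energy_Mellin_bound[of "Complex a (- t)" "\<lambda>x. iexp (t * \<kappa> x)"] a0 a pos fin by simp
    qed
    also have "norm (Gamma (Complex q t)) \<le> C * norm (Complex q t) powr (- (1 + \<epsilon>)) * norm (Gamma (Complex a (- t)))"
    proof -
      have "norm (Gamma (Complex a (- t))) = norm (Gamma (Complex a t))"
        using arg_cong[OF cnj_Gamma[of "Complex a t"], of norm] by (simp add: complex_cnj)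
      then show ?thesis using C(2)[of t] Gp by (simp add: divide_le_eq)
    qed
    finally have "norm (Gamma (Complex a (- t))) * (energy a * norm (char N t)) \<le>
       C * norm (Complex q t) powr (- (1 + \<epsilon>)) * norm (Gamma (Complex a (- t))) / Gamma q * Gamma a * energy a"
      using Gq E by (simp add: divide_right_mono mult_right_mono)
    then have "(norm (Gamma (Complex a (- t))) * energy a) * norm (char N t) \<le>
       (norm (Gamma (Complex a (- t))) * energy a) * (K * norm (Complex q t) powr (- (1 + \<epsilon>)))"
      by (simp add: K_def field_simps)
    then show ?thesis using Gp E by (simp add: mult_le_cancel_left_pos)
  qed
  have "integrable lborel (char N)"
  proof (rule Bochner_Integration.integrable_bound)
    show "integrable lborel (\<lambda>t. K * norm (Complex q t) powr (- (1 + \<epsilon>)))"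
      using integrable_norm_Complex_powr[OF q(1), of "1 + \<epsilon>"] \<epsilon> by simp
    show "AE t in lborel. norm (char N t) \<le> norm (K * norm (Complex q t) powr - (1 + \<epsilon>))"
      by (intro AE_I2 order_trans[OF bound]) simp
  qed (simp add: N.char_measurable)
  then obtain l r where lr: "l < r" "\<And>s t. l \<le> s \<Longrightarrow> s < t \<Longrightarrow> t \<le> r \<Longrightarrow> 0 < measure N {s<..t}"
    using N.positive_on_interval_if_char_integrable by blast
  show thesis
  proof (rule that[OF lr(1)], rule ccontr)
    fix s t
    assume st: "l \<le> s" "s < t" "t \<le> r"
      and neg: "\<not> (\<exists>x\<in>space M. \<exists>y\<in>space M. 0 < sqdist (x, y) \<and> ln (sqdist (x, y)) + \<kappa> x + \<kappa> y \<in> {s<..t})"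
    have "AE z in M \<Otimes>\<^sub>M M. T z \<notin> {s<..t}"
      using pos AE_space[of "M \<Otimes>\<^sub>M M"]
    proof eventually_elim
      case (elim z)
      then show ?case using neg by (cases z) (auto simp: T_def space_pair_measure)
    qed
    then have "AE z in Q. T z \<notin> {s<..t}"
      unfolding Q_def by (subst AE_density) (auto elim!: eventually_mono)
    then have "AE v in N. v \<notin> {s<..t}" unfolding N_def by (subst AE_distr_iff) auto
    then have "measure N {s<..t} = 0"
      using N.prob_eq_0[of "{s<..t}"] by simp
    then show False using lr(2)[OF st] by simp
  qed
qed

end

section \<open>Angles seen from a point\<close>

definition cosine :: "'a::real_inner \<Rightarrow> 'a \<Rightarrow> real" where
  "cosine v w = (v \<bullet> w) / (norm v * norm w)"

lemma cosine_sgn: "cosine v w = sgn v \<bullet> sgn w"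
  by (simp add: cosine_def sgn_div_norm divide_inverse mult_ac)

lemma cosine_self: "v \<noteq> 0 \<Longrightarrow> cosine v v = 1"
  by (simp add: cosine_def power2_norm_eq_inner[symmetric] power2_eq_square)

lemma cosine_bounds: "-1 \<le> cosine v w" "cosine v w \<le> 1"
proof -
  have "\<bar>cosine v w\<bar> \<le> 1"
    unfolding cosine_sgn using Cauchy_Schwarz_ineq2[of "sgn v" "sgn w"]
    by (auto simp: norm_sgn split: if_splits)
  then show "-1 \<le> cosine v w" "cosine v w \<le> 1" by auto
qed

lemma angle_eq: "angle x z y = arccos (cosine (x - z) (y - z))"
  by (simp add: angle_def cosine_def)

text \<open>Stereographic projection of the direction of \<open>v\<close> along the \<open>k\<close>-th axis, from the pole with
  \<open>k\<close>-th coordinate \<open>-\<sigma>\<close>, where \<open>\<sigma> = 1\<close> or \<open>\<sigma> = -1\<close>. Only the coordinates \<open>i \<noteq> k\<close> are meaningful.\<close>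

definition stereo :: "real \<Rightarrow> 'n \<Rightarrow> real^'n \<Rightarrow> 'n \<Rightarrow> real" where
  "stereo \<sigma> k v i = sgn v $ i / (1 + \<sigma> * sgn v $ k)"

text \<open>Stereographic projection is conformal, and the distortion of a chord is the geometric mean of
  the conformal factors at its two ends.\<close>

lemma stereo_sqdist:
  fixes v w :: "real^'n"
  assumes "\<sigma>\<^sup>2 = 1" "v \<noteq> 0" "w \<noteq> 0" "0 < 1 + \<sigma> * sgn v $ k" "0 < 1 + \<sigma> * sgn w $ k"
  shows "(\<Sum>i\<in>UNIV - {k}. (stereo \<sigma> k v i - stereo \<sigma> k w i)\<^sup>2) =
    2 * (1 - cosine v w) / ((1 + \<sigma> * sgn v $ k) * (1 + \<sigma> * sgn w $ k))"
proof -
  define a b where "a = sgn v" and "b = sgn w"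
  define A B where "A = 1 + \<sigma> * a $ k" and "B = 1 + \<sigma> * b $ k"
  have AB: "0 < A" "0 < B" using assms by (auto simp: A_def B_def a_def b_def)
  have inner: "(\<Sum>i\<in>UNIV - {k}. x $ i * y $ i) = x \<bullet> y - (\<sigma> * x $ k) * (\<sigma> * y $ k)" for x y :: "real^'n"
  proof -
    have "x \<bullet> y = x $ k * y $ k + (\<Sum>i\<in>UNIV - {k}. x $ i * y $ i)"
      unfolding inner_vec_def by (subst sum.remove[of UNIV k]) auto
    moreover have "(\<sigma> * x $ k) * (\<sigma> * y $ k) = \<sigma>\<^sup>2 * (x $ k * y $ k)"
      by (simp add: power2_eq_square mult_ac)
    ultimately show ?thesis using assms(1) by simp
  qed
  have unit: "a \<bullet> a = 1" "b \<bullet> b = 1"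
    using assms by (simp_all add: a_def b_def norm_sgn power2_norm_eq_inner[symmetric])
  have "(\<Sum>i\<in>UNIV - {k}. (stereo \<sigma> k v i - stereo \<sigma> k w i)\<^sup>2) =
     (\<Sum>i\<in>UNIV - {k}. a $ i * a $ i / A\<^sup>2 + b $ i * b $ i / B\<^sup>2 - 2 * (a $ i * b $ i) / (A * B))"
    using AB by (intro sum.cong refl) (simp add: stereo_def a_def[symmetric] b_def[symmetric] A_def[symmetric] B_def[symmetric]
        power2_eq_square field_simps)
  also have "\<dots> = (\<Sum>i\<in>UNIV - {k}. a $ i * a $ i) / A\<^sup>2 + (\<Sum>i\<in>UNIV - {k}. b $ i * b $ i) / B\<^sup>2 - 2 * (\<Sum>i\<in>UNIV - {k}. a $ i * b $ i) / (A * B)"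
    by (simp add: sum.distrib sum_subtractf sum_divide_distrib sum_distrib_left)
  also have "\<dots> = (1 - (A - 1) * (A - 1)) / A\<^sup>2 + (1 - (B - 1) * (B - 1)) / B\<^sup>2 - 2 * (a \<bullet> b - (A - 1) * (B - 1)) / (A * B)"
    unfolding inner unit by (simp add: A_def B_def)
  also have "\<dots> = 2 * (1 - a \<bullet> b) / (A * B)"
    using AB by (simp add: field_simps power2_eq_square)
  finally show ?thesis by (simp add: cosine_sgn a_def b_def A_def B_def)
qed

lemma norm_diff_sgn_sq:
  fixes v w :: "'a::real_inner"
  assumes "v \<noteq> 0" "w \<noteq> 0"
  shows "(norm (sgn v - sgn w))\<^sup>2 = 2 * (1 - cosine v w)"
proof -
  have "sgn v \<bullet> sgn v = 1" "sgn w \<bullet> sgn w = 1"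
    using assms by (simp_all add: norm_sgn power2_norm_eq_inner[symmetric])
  then show ?thesis by (simp add: power2_norm_eq_inner cosine_sgn inner_diff inner_commute)
qed

text \<open>All points of \<open>A\<close> have almost the direction \<open>b\<close> from \<open>z\<close>, so \<open>A\<close> lies near a segment of length
  \<open>R\<close>. The segment is covered by \<open>O(1/r)\<close> balls of radius \<open>O(r)\<close>: one power of \<open>r\<close> is lost.\<close>

lemma cone_measure_le:
  fixes \<mu> :: "(real^'n) measure"
  assumes "finite_measure \<mu>" and sets: "sets \<mu> = sets borel"
    and s: "0 < s" and C: "0 < C" and ball: "\<And>x r. 0 < r \<Longrightarrow> measure \<mu> (cball x r) \<le> C * r powr s"
    and r: "0 < r" "r \<le> 1" and R: "0 \<le> R" and A: "A \<in> sets \<mu>"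
    and sub: "\<And>y. y \<in> A \<Longrightarrow> norm (y - z) \<le> R \<and> norm (sgn (y - z) - b) \<le> 2 * r"
    and b: "norm b \<le> 1"
  shows "measure \<mu> A \<le> (R + 1) * C * (2 * R + 1) powr s * r powr (s - 1)"
proof -
  interpret finite_measure \<mu> by fact
  define N where "N = nat \<lfloor>R / r\<rfloor>"
  define \<rho> where "\<rho> = (2 * R + 1) * r"
  have \<rho>: "0 < \<rho>" using R r by (simp add: \<rho>_def)
  have cov: "A \<subseteq> (\<Union>j\<in>{..N}. cball (z + (real j * r) *\<^sub>R b) \<rho>)"
  proof
    fix y assume y: "y \<in> A"
    define j where "j = nat \<lfloor>norm (y - z) / r\<rfloor>"
    have j1: "real j \<le> norm (y - z) / r" "norm (y - z) / r < real j + 1"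
      using r by (simp_all add: j_def of_nat_nat)
    have "j \<le> N" unfolding j_def N_def using sub[OF y] r
      by (intro nat_mono floor_mono divide_right_mono) auto
    moreover have "dist (z + (real j * r) *\<^sub>R b) y \<le> \<rho>"
    proof -
      have "y - z = norm (y - z) *\<^sub>R sgn (y - z)"
        by (cases "y = z") (simp_all add: sgn_div_norm)
      then have "y - (z + (real j * r) *\<^sub>R b) = norm (y - z) *\<^sub>R (sgn (y - z) - b) + (norm (y - z) - real j * r) *\<^sub>R b"
        by (simp add: algebra_simps)
      then have "norm (y - (z + (real j * r) *\<^sub>R b)) \<le> norm (y - z) * norm (sgn (y - z) - b) + \<bar>norm (y - z) - real j * r\<bar> * norm b"
        using norm_triangle_ineq[of "norm (y - z) *\<^sub>R (sgn (y - z) - b)" "(norm (y - z) - real j * r) *\<^sub>R b"] by simp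
      also have "\<dots> \<le> R * (2 * r) + r * 1"
      proof (intro add_mono mult_mono)
        show "\<bar>norm (y - z) - real j * r\<bar> \<le> r" using j1 r by (simp add: field_simps abs_le_iff)
      qed (use sub[OF y] b r R in auto)
      also have "\<dots> = \<rho>" by (simp add: \<rho>_def algebra_simps)
      finally show ?thesis by (simp add: dist_norm norm_minus_commute)
    qed
    ultimately show "y \<in> (\<Union>j\<in>{..N}. cball (z + (real j * r) *\<^sub>R b) \<rho>)" by auto
  qed
  have "measure \<mu> A \<le> measure \<mu> (\<Union>j\<in>{..N}. cball (z + (real j * r) *\<^sub>R b) \<rho>)"
    using sets by (intro finite_measure_mono cov) auto
  also have "\<dots> \<le> (\<Sum>j\<in>{..N}. measure \<mu> (cball (z + (real j * r) *\<^sub>R b) \<rho>))"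
    by (intro measure_UNION_le) (simp_all add: sets)
  also have "\<dots> \<le> (\<Sum>j\<in>{..N}. C * \<rho> powr s)" by (intro sum_mono ball \<rho>)
  also have "\<dots> = (real N + 1) * (C * \<rho> powr s)" by simp
  also have "\<dots> \<le> ((R + 1) / r) * (C * \<rho> powr s)"
  proof (intro mult_right_mono)
    have "real N \<le> R / r" using R r by (simp add: N_def of_nat_nat)
    moreover have "1 \<le> 1 / r" using r by simp
    ultimately show "real N + 1 \<le> (R + 1) / r" by (simp add: add_divide_distrib)
  qed (use C in auto)
  also have "\<dots> = (R + 1) * C * (2 * R + 1) powr s * (r powr s / r)"
    using r R by (simp add: \<rho>_def powr_mult)
  also have "r powr s / r = r powr (s - 1)" using r by (simp add: powr_diff)
  finally show ?thesis .
qed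

theorem corollary1p2:
  fixes E :: "(real ^ 'n) set"
  assumes "CARD('n) \<ge> 4"
    and "compact E"
    and "hausdorff_dim E > ereal (2 / 3 * real CARD('n) + 1)"
  shows "interior (angle_set E) \<noteq> {}"
proof -
  define d where "d = real CARD('n)"
  have d: "4 \<le> d" using assms(1) by (simp add: d_def)
  obtain s where s: "2 / 3 * d + 1 < s" "ereal s < hausdorff_dim E"
    using ereal_dense2[OF assms(3)] by (auto simp: d_def)
  have hm: "hausdorff_measure s E \<noteq> 0"
  proof
    assume "hausdorff_measure s E = 0"
    then have "hausdorff_dim E \<le> ereal s"
      unfolding hausdorff_dim_def using s d by (intro INF_lower) auto
    then show False using s by simp
  qed
  obtain \<mu> :: "(real^'n) measure" and C where \<mu>: "finite_measure \<mu>" "sets \<mu> = sets borel" "AE x in \<mu>. x \<in> E" "0 < measure \<mu> UNIV"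
    and C: "0 < C" and ball: "\<And>x r. 0 < r \<Longrightarrow> measure \<mu> (cball x r) \<le> C * r powr s"
    using frostman[OF assms(2) _ hm] s d by auto
  interpret mu: finite_measure \<mu> by (rule \<mu>(1))
  note [measurable_cong] = \<mu>(2)
  have space_mu: "space \<mu> = UNIV" using sets_eq_imp_space_eq[OF \<mu>(2)] by simp
  define m where "m = measure \<mu> UNIV"
  have m: "0 < m" using \<mu>(4) by (simp add: m_def)
  have "E \<noteq> {}"
  proof
    assume "E = {}"
    then have "measure \<mu> UNIV = measure \<mu> {}"
      using \<mu>(3) by (intro mu.finite_measure_eq_AE) (auto simp: \<mu>(2))
    then show False using \<mu>(4) by simp
  qed
  then obtain z where z: "z \<in> E" by auto
  \<comment> \<open>The axis of the projection is arbitrary.\<close>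
  define k :: 'n where "k = undefined"
  \<comment> \<open>The ball around \<open>z\<close> of this radius carries at most half of the mass.\<close>
  define \<rho> where "\<rho> = (m / (2 * C)) powr (1 / s)"
  have \<rho>: "0 < \<rho>" using m C by (simp add: \<rho>_def)
  have small: "measure \<mu> (cball z \<rho>) \<le> m / 2"
  proof -
    have "\<rho> powr s = m / (2 * C)" using m C s d by (simp add: \<rho>_def powr_powr)
    then show ?thesis using ball[OF \<rho>, of z] C by simp
  qed
  \<comment> \<open>Restrict to a closed half space and away from \<open>z\<close>, so that all directions stay away from the pole
    of the projection and from the singularity at \<open>z\<close>.\<close>
  define P where "P \<sigma> = {x \<in> E. \<rho> \<le> norm (x - z) \<and> 0 \<le> \<sigma> * (x - z) $ k}" for \<sigma> :: real
  have P_closed: "closed (P \<sigma>)" for \<sigma>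
  proof -
    have "P \<sigma> = E \<inter> {x. \<rho> \<le> norm (x - z)} \<inter> {x. 0 \<le> \<sigma> * (x - z) $ k}" by (auto simp: P_def)
    then show ?thesis using compact_imp_closed[OF assms(2)]
      by (auto intro!: closed_Int closed_Collect_le continuous_intros)
  qed
  have "\<exists>\<sigma>\<in>{1, -1}. 0 < measure \<mu> (P \<sigma>)"
  proof (rule ccontr)
    assume "\<not> ?thesis"
    then have "measure \<mu> (P 1) = 0" "measure \<mu> (P (-1)) = 0"
      by (auto simp: not_less measure_le_0_iff)
    moreover have "AE x in \<mu>. x \<in> cball z \<rho> \<union> P 1 \<union> P (-1)"
      using \<mu>(3) by eventually_elim (auto simp: P_def dist_norm norm_minus_commute)
    then have "measure \<mu> UNIV = measure \<mu> (cball z \<rho> \<union> P 1 \<union> P (-1))"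
      using P_closed by (intro mu.finite_measure_eq_AE) (auto simp: \<mu>(2))
    moreover have "measure \<mu> (cball z \<rho> \<union> P 1 \<union> P (-1)) \<le> measure \<mu> (cball z \<rho>) + measure \<mu> (P 1) + measure \<mu> (P (-1))"
      using P_closed by (intro order_trans[OF measure_Un_le] add_right_mono measure_Un_le) (auto simp: \<mu>(2))
    ultimately show False using small m by (simp add: m_def)
  qed
  then obtain \<sigma> where "\<sigma> \<in> {1, -1}" "0 < measure \<mu> (P \<sigma>)" by blast
  then have \<sigma>: "\<sigma>\<^sup>2 = 1" "0 < measure \<mu> (P \<sigma>)" by auto
  define Q where "Q = P \<sigma>"
  have Q_sets [measurable]: "Q \<in> sets \<mu>" using P_closed[of \<sigma>] by (simp add: Q_def \<mu>(2))
  have Qc: "compact Q"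
    using compact_Int_closed[OF assms(2) P_closed[of \<sigma>]] by (simp add: Q_def P_def Int_absorb1 Collect_conj_eq Int_assoc[symmetric])
  have Q: "x \<in> E" "\<rho> \<le> norm (x - z)" "x - z \<noteq> 0" "0 \<le> \<sigma> * sgn (x - z) $ k" if "x \<in> Q" for x
    using that \<rho> by (auto simp: Q_def P_def sgn_div_norm mult.left_commute[of \<sigma>])
  \<comment> \<open>The distortion of chords under the projection at the direction of \<open>x - z\<close>, as \<open>stereo_sqdist\<close>
    counts it.\<close>
  define A where "A x = 1 + \<sigma> * sgn (x - z) $ k" for x
  have A: "1 \<le> A x" "A x \<le> 2" if "x \<in> Q" for x
  proof -
    show "1 \<le> A x" using Q(4)[OF that] by (simp add: A_def)
    have "\<bar>\<sigma>\<bar> = 1" using \<sigma>(1) by (auto simp: power2_eq_1_iff)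
    have "\<bar>\<sigma> * sgn (x - z) $ k\<bar> \<le> 1 * 1"
      unfolding abs_mult \<open>\<bar>\<sigma>\<bar> = 1\<close> using component_le_norm_cart[of "sgn (x - z)" k]
      by (intro mult_left_mono) (auto simp: norm_sgn split: if_splits)
    then show "A x \<le> 2" by (simp add: A_def abs_le_iff)
  qed
  have sgn_meas: "(\<lambda>x. sgn (x - z) $ i) \<in> borel_measurable \<mu>" for i
  proof -
    have "(\<lambda>x. (x - z) $ i / norm (x - z)) \<in> borel_measurable borel"
      by (intro borel_measurable_divide borel_measurable_continuous_onI continuous_intros)
    moreover have "sgn (x - z) $ i = (x - z) $ i / norm (x - z)" for x
      by (simp add: sgn_div_norm divide_inverse mult.commute)
    ultimately show ?thesis by (simp add: \<mu>(2) cong: measurable_cong_sets)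
  qed
  define M where "M = restrict_space \<mu> Q"
  define I where "I = UNIV - {k}"
  define u where "u x = stereo \<sigma> k (x - z)" for x
  have cardI: "real (card I) = d - 1" using d by (simp add: I_def d_def card_Diff_singleton of_nat_diff)
  interpret measured_points M I u
  proof (intro measured_points.intro measured_points_axioms.intro)
    show "finite_measure M" unfolding M_def by (rule finite_measure_restrict_space[OF \<mu>(1) Q_sets])
    show "finite I" by simp
    show "I \<noteq> {}" using cardI d by auto
    show "(\<lambda>x. u x i) \<in> borel_measurable M" if "i \<in> I" for i
      unfolding M_def u_def stereo_def
      by (intro measurable_restrict_space1 borel_measurable_divide borel_measurable_add borel_measurable_times sgn_meas) auto
  qed
  have space_M: "space M = Q" by (simp add: M_def space_restrict_space space_mu)
  have measure_M: "measure M B = measure \<mu> B" if "B \<subseteq> Q" for B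
    unfolding M_def using that Q_sets space_mu by (intro measure_restrict_space) auto
  have sets_M: "B \<in> sets M \<Longrightarrow> B \<in> sets \<mu>" for B
    using Q_sets by (auto simp: M_def sets_restrict_space)
  have sq: "sqdist (x, y) = 2 * (1 - cosine (x - z) (y - z)) / (A x * A y)" if "x \<in> Q" "y \<in> Q" for x y
  proof -
    have "sqdist (x, y) = (\<Sum>i\<in>UNIV - {k}. (stereo \<sigma> k (x - z) i - stereo \<sigma> k (y - z) i)\<^sup>2)"
      unfolding sqdist_def fst_conv snd_conv by (simp only: u_def I_def)
    also have "\<dots> = 2 * (1 - cosine (x - z) (y - z)) / (A x * A y)"
      unfolding A_def using Q(4)[OF that(1)] Q(4)[OF that(2)]
      by (intro stereo_sqdist \<sigma>(1) Q(3)[OF that(1)] Q(3)[OF that(2)]) linarith+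
    finally show ?thesis .
  qed
  obtain R where R: "0 \<le> R" "\<And>x. x \<in> E \<Longrightarrow> norm (x - z) \<le> R"
  proof -
    have "bounded ((\<lambda>x. x - z) ` E)"
      using assms(2) by (intro compact_imp_bounded compact_continuous_image continuous_intros)
    then obtain B where "\<And>x. x \<in> E \<Longrightarrow> norm (x - z) \<le> B" by (auto simp: bounded_iff)
    then show thesis using that[of "\<bar>B\<bar>"] by fastforce
  qed
  define C' where "C' = (R + 1) * C * (2 * R + 1) powr s"
  have C': "0 \<le> C'" using R C by (simp add: C'_def)
  have tube: "measure M {y \<in> space M. sqdist (x, y) \<le> r\<^sup>2} \<le> C' * r powr (s - 1)"
    if x: "x \<in> space M" and r: "0 < r" "r \<le> 1" for x r
  proof -
    define B where "B = {y \<in> space M. sqdist (x, y) \<le> r\<^sup>2}"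
    have "B \<in> sets M" unfolding B_def by (rule sqdist_ball_meas[OF x])
    have BQ: "B \<subseteq> Q" by (auto simp: B_def space_M)
    have "measure \<mu> B \<le> C' * r powr (s - 1)"
      unfolding C'_def
    proof (rule cone_measure_le[OF \<mu>(1,2) _ C ball r R(1) sets_M[OF \<open>B \<in> sets M\<close>]])
      show "norm (y - z) \<le> R \<and> norm (sgn (y - z) - sgn (x - z)) \<le> 2 * r" if "y \<in> B" for y
      proof
        have xQ: "x \<in> Q" and yQ: "y \<in> Q" using x that by (auto simp: B_def space_M)
        show "norm (y - z) \<le> R" using R(2) Q(1)[OF yQ] by auto
        have "(norm (sgn (y - z) - sgn (x - z)))\<^sup>2 = sqdist (x, y) * (A x * A y)"
          unfolding sq[OF xQ yQ] using A(1)[OF xQ] A(1)[OF yQ] Q(3)[OF xQ] Q(3)[OF yQ]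
          by (subst norm_minus_commute, subst norm_diff_sgn_sq) auto
        also have "\<dots> \<le> r\<^sup>2 * (2 * 2)"
          using that A[OF xQ] A[OF yQ] by (intro mult_mono) (auto simp: B_def)
        also have "\<dots> = (2 * r)\<^sup>2" by (simp add: power2_eq_square)
        finally show "norm (sgn (y - z) - sgn (x - z)) \<le> 2 * r"
          by (rule power2_le_imp_le) (use r in simp)
      qed
      show "norm (sgn (x - z)) \<le> 1" by (simp add: norm_sgn)
    qed (use s d in auto)
    then show ?thesis using measure_M[OF BQ] by (simp add: B_def)
  qed
  \<comment> \<open>Both \<open>s - 1\<close> and \<open>n = d - 1\<close> exceed \<open>n/2 + 1 = (d + 1)/2\<close> by more than \<open>(d - 3)/6\<close>; this leaves
    room for \<open>2a = n/2 + 1 + \<epsilon>\<close>.\<close>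
  define \<epsilon> where "\<epsilon> = min 1 ((d - 3) / 6) / 2"
  have \<epsilon>: "0 < \<epsilon>" "\<epsilon> < 1" "\<epsilon> < (d - 3) / 6" using d by (auto simp: \<epsilon>_def min_def)
  define a where "a = real (card I) / 4 + (1 + \<epsilon>) / 2"
  have a: "0 < a" "a < real (card I) / 2" "2 * a < s - 1"
    using \<epsilon> d s by (simp_all add: a_def cardI field_simps)
  have pos: "AE w in M \<Otimes>\<^sub>M M. 0 < sqdist w"
    by (rule sqdist_pos_AE[OF _ C' tube]) (use s d in auto)
  have fin: "integrable (M \<Otimes>\<^sub>M M) (\<lambda>w. exp (- a * ln (sqdist w)))"
    by (rule energy_finite[OF a(1,3) C' tube])
  have A_meas: "(\<lambda>x. ln (A x)) \<in> borel_measurable M"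
    unfolding M_def A_def
    by (intro measurable_restrict_space1 borel_measurable_ln borel_measurable_add borel_measurable_times sgn_meas) auto
  have M_pos: "0 < measure M (space M)" using \<sigma>(2) measure_M[of Q] by (simp add: space_M Q_def)
  obtain l r where lr: "l < r" and dense: "\<And>s t. l \<le> s \<Longrightarrow> s < t \<Longrightarrow> t \<le> r \<Longrightarrow>
    \<exists>x\<in>space M. \<exists>y\<in>space M. 0 < sqdist (x, y) \<and> ln (sqdist (x, y)) + ln (A x) + ln (A y) \<in> {s<..t}"
    using log_distances_somewhere_dense[OF A_meas \<epsilon>(1,2) a(2)[unfolded a_def] pos fin[unfolded a_def] M_pos] by blast
  \<comment> \<open>The values \<open>2 (1 - cos \<theta>)\<close> form a compact set, and their logarithms are dense in the interval.\<close>
  define F where "F = (\<lambda>(x, y). 2 * (1 - cosine (x - z) (y - z))) ` (Q \<times> Q)"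
  have "compact F"
    unfolding F_def cosine_def case_prod_beta'
    by (intro compact_continuous_image compact_Times Qc continuous_intros) (use Q(3) in auto)
  then have F_closed: "closed F" by (rule compact_imp_closed)
  have exp_F: "exp t \<in> F" if t: "l < t" "t < r" for t
  proof -
    have "exp t \<in> closure F"
      unfolding closure_approachable
    proof (intro allI impI)
      fix e :: real assume "0 < e"
      have "isCont exp t" by simp
      then obtain \<delta> where \<delta>: "0 < \<delta>" "\<And>v. \<bar>v - t\<bar> < \<delta> \<Longrightarrow> \<bar>exp v - exp t\<bar> < e"
        using \<open>0 < e\<close> unfolding continuous_at_eps_delta dist_real_def by blast
      have "max l (t - \<delta> / 2) < t" using t \<delta> by simp
      then obtain x y where xy: "x \<in> Q" "y \<in> Q" "0 < sqdist (x, y)"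
        "ln (sqdist (x, y)) + ln (A x) + ln (A y) \<in> {max l (t - \<delta> / 2)<..t}"
        using dense[of "max l (t - \<delta> / 2)" t] t by (auto simp: space_M)
      define v where "v = ln (sqdist (x, y)) + ln (A x) + ln (A y)"
      have Apos: "0 < A x" "0 < A y" using A(1)[OF xy(1)] A(1)[OF xy(2)] by auto
      have "exp v = sqdist (x, y) * A x * A y"
        using xy(3) Apos by (simp add: v_def exp_add)
      also have "\<dots> = 2 * (1 - cosine (x - z) (y - z))"
        unfolding sq[OF xy(1,2)] using Apos by simp
      finally have "exp v \<in> F" unfolding F_def using xy by (auto intro!: image_eqI[of _ _ "(x, y)"])
      moreover have "\<bar>v - t\<bar> < \<delta>" using xy(4) \<delta>(1) by (auto simp: v_def[symmetric] abs_less_iff)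
      ultimately show "\<exists>y\<in>F. dist y (exp t) < e" using \<delta>(2) by (auto simp: dist_real_def)
    qed
    then show ?thesis using F_closed by simp
  qed
  \<comment> \<open>On \<open>(0, \<pi>)\<close> the cosine determines the angle, so the open set \<open>U\<close> consists of angles of \<open>E\<close>.\<close>
  define U where "U = {\<theta>\<in>{0<..<pi}. exp l < 2 * (1 - cos \<theta>) \<and> 2 * (1 - cos \<theta>) < exp r}"
  have "open U"
  proof -
    have "U = {0<..<pi} \<inter> {\<theta>. exp l < 2 * (1 - cos \<theta>)} \<inter> {\<theta>. 2 * (1 - cos \<theta>) < exp r}"
      by (auto simp: U_def)
    then show ?thesis by (auto intro!: open_Int open_Collect_less continuous_intros)
  qed
  moreover have "U \<subseteq> angle_set E"
  proof
    fix \<theta> assume \<theta>: "\<theta> \<in> U"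
    define t where "t = ln (2 * (1 - cos \<theta>))"
    have p: "0 < 2 * (1 - cos \<theta>)" using \<theta> exp_gt_zero[of l] unfolding U_def by (simp only: mem_Collect_eq) linarith
    have et: "exp t = 2 * (1 - cos \<theta>)" using p by (simp add: t_def)
    have "exp l < exp t" "exp t < exp r" unfolding et using \<theta> by (auto simp: U_def)
    then have "exp t \<in> F" by (intro exp_F) auto
    then obtain x y where xy: "x \<in> Q" "y \<in> Q" "cosine (x - z) (y - z) = cos \<theta>"
      unfolding et F_def by auto
    have "cos \<theta> \<noteq> 1" using p by auto
    then have "x \<noteq> y" using xy(3) cosine_self[OF Q(3)[OF xy(1)]] by auto
    moreover have "angle x z y = \<theta>"
      unfolding angle_eq xy(3) using \<theta> by (auto simp: U_def intro: arccos_cos)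
    ultimately show "\<theta> \<in> angle_set E"
      unfolding angle_set_def using Q(1,3)[OF xy(1)] Q(1,3)[OF xy(2)] z by force
  qed
  moreover have "U \<noteq> {}"
  proof -
    \<comment> \<open>The bound \<open>exp t2 \<le> 4\<close> makes \<open>exp t1 < 4\<close> strict, which keeps the angle below \<open>\<pi>\<close>.\<close>
    define t1 t2 where "t1 = l + (r - l) / 3" and "t2 = l + 2 * (r - l) / 3"
    have t: "l < t1" "t1 < t2" "t2 < r" using lr by (auto simp: t1_def t2_def field_simps)
    have "exp t2 \<in> F" using t by (intro exp_F) auto
    then obtain x y where "exp t2 = 2 * (1 - cosine (x - z) (y - z))" unfolding F_def by auto
    moreover have "2 * (1 - cosine (x - z) (y - z)) \<le> 2 * 2"
      by (intro mult_left_mono) (use cosine_bounds(1)[of "x - z" "y - z"] in auto)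
    ultimately have "exp t2 \<le> 4" by simp
    moreover have "exp t1 < exp t2" using t by simp
    ultimately have "exp t1 < 4" by (rule less_le_trans[rotated])
    then have t1: "0 < exp t1" "exp t1 < 4" by auto
    define \<theta> where "\<theta> = arccos (1 - exp t1 / 2)"
    have cos\<theta>: "cos \<theta> = 1 - exp t1 / 2" unfolding \<theta>_def using t1 by (intro cos_arccos) auto
    have "0 < \<theta>" "\<theta> < pi" unfolding \<theta>_def using t1 by (auto intro!: arccos_lt_bounded[THEN conjunct1] arccos_lt_bounded[THEN conjunct2])
    moreover have "2 * (1 - cos \<theta>) = exp t1" using cos\<theta> by simp
    ultimately have "\<theta> \<in> U" using t by (auto simp: U_def)
    then show ?thesis by auto
  qed
  ultimately show ?thesis by (metis interior_maximal subset_empty)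
qed

end
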